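(* Let $k\{Y\}=k\{y_1,\ldots,y_l\}$ be a ring of differential polynomials over a differential field $k$ of characteristic zero, with a fixed ranking. Let $\mathbb{C} = C_1,\ldots,C_p$ be the canonical characteristic set of a characterizable differential ideal $I$. Let $v$ be a differential variable appearing in some $C_i$, $1\leq i\leq p$. Then $$\frac{\partial C_i}{\partial v} \notin I.$$
   Context: $\Delta=\{\delta_1,\ldots,\delta_n\}$ is a finite set of commuting derivations, $\Theta$ the free commutative monoid of derivative operators $\delta_1^{k_1}\cdots\delta_n^{k_n}$. $k\{Y\}$ is the polynomial ring over $k$ in the differential variables $\Theta Y=\{\theta y_j\}$. $[F]$ is the differential ideal generated by $F$. A ranking is a total order on $\Theta Y$ such that $\theta u\geq u$ and ($u\geq v\Rightarrow\theta u\geq\theta v$). The leader $u_f$ of $f\notin k$ is the highest differential variable in $f$; if $d=\deg_{u_f}f$, the initial $I_f$ is the coefficient of $u_f^d$, the separant is $S_f=\partial f/\partial u_f$, and the rank is $u_f^d$. Ranks are compared by $u^{d}>v^{e}$ iff $u>v$, or $u=v$ and $d>e$. $f$ is reduced with respect to $g$ if no proper derivative of $u_g$ appears in $f$ and $\deg_{u_g}f<\deg_{u_g}g$. A set $\mathbb{A}\subset k\{Y\}\setminus k$ is autoreduced if each element is reduced with respect to all the others; such sets are finite and written in order of increasing rank. $\mathbb{A}=A_1,\ldots,A_r$ has lower rank than $\mathbb{B}=B_1,\ldots,B_s$ if there is $j\le r,s$ with $\operatorname{rank}A_i=\operatorname{rank}B_i$ for $i<j$ and $\operatorname{rank}A_j<\operatorname{rank}B_j$,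 or if $r>s$ and $\operatorname{rank}A_i=\operatorname{rank}B_i$ for $1\le i\le s$. A characteristic set of an ideal is an autoreduced subset of it of lowest rank. $H_{\mathbb{A}}$ is the product of the initials and separants of the elements of $\mathbb{A}$, and $J:H_{\mathbb{A}}^\infty=\{a : H_{\mathbb{A}}^m a\in J\text{ for some }m\geq0\}$. A differential ideal $I$ is characterizable if $I=[\mathbb{A}]:H_{\mathbb{A}}^\infty$ for some characteristic set $\mathbb{A}$ of $I$. All characteristic sets of $I$ have the same set of leaders $L$; the set of non-leaders is $N=\Theta Y\setminus\Theta L$. $>_{\rm lex}$ is the lexicographic order on power products of differential variables induced by the ranking. A characteristic set $\mathbb{C}=C_1,\ldots,C_p$ of a characterizable ideal $I$ is canonical if (1) $I_{C_i}\in k[N]$ for all $i$; (2) for each $i$, $C_i$ has no factors in $k[N]$ (other than constants of $k$), and the coefficient in $I_{C_i}$ of its leading monomial with respect to $>_{\rm lex}$ equals $1$. The canonical characteristic set exists and is unique. *)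

theory Defs
  imports Complex_Main "HOL-Library.Poly_Mapping"
begin

text \<open>
  The type \<open>'d\<close> indexes the derivations and \<open>'y\<close> the differential indeterminates.
  The free commutative monoid of derivative operators is \<open>'d \<Rightarrow>\<^sub>0 nat\<close>, written additively,
  and \<open>(\<theta>, j)\<close> stands for the differential variable \<open>\<theta> y\<^sub>j\<close>.
  Differential polynomials are the finitely supported functions from power products to the
  coefficient field, with the convolution product of \<^theory>\<open>HOL-Library.Poly_Mapping\<close>.
\<close>

type_synonym ('d, 'y) dvar = "('d \<Rightarrow>\<^sub>0 nat) \<times> 'y"

type_synonym ('d, 'y) pprod = "('d, 'y) dvar \<Rightarrow>\<^sub>0 nat"

type_synonym ('d, 'y, 'k) dpoly = "('d, 'y) pprod \<Rightarrow>\<^sub>0 'k"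

definition differential_field :: "('d \<Rightarrow> 'k::field \<Rightarrow> 'k) \<Rightarrow> bool" where
  "differential_field der \<longleftrightarrow>
     (\<forall>i a b. der i (a + b) = der i a + der i b) \<and>
     (\<forall>i a b. der i (a * b) = der i a * b + a * der i b) \<and>
     (\<forall>i j a. der i (der j a) = der j (der i a))"

definition apply_op :: "('d \<Rightarrow>\<^sub>0 nat) \<Rightarrow> ('d, 'y) dvar \<Rightarrow> ('d, 'y) dvar" where
  "apply_op \<theta> u = (\<theta> + fst u, snd u)"

definition const_dpoly :: "'k::zero \<Rightarrow> ('d, 'y, 'k) dpoly" where
  "const_dpoly c = Poly_Mapping.single 0 c"

definition var_dpoly :: "('d, 'y) dvar \<Rightarrow> ('d, 'y, 'k::zero_neq_one) dpoly" where
  "var_dpoly u = Poly_Mapping.single (Poly_Mapping.single u 1) 1"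

definition dvars :: "('d, 'y, 'k::zero) dpoly \<Rightarrow> ('d, 'y) dvar set" where
  "dvars f = (\<Union>m\<in>Poly_Mapping.keys f. Poly_Mapping.keys m)"

definition polys_in :: "('d, 'y) dvar set \<Rightarrow> ('d, 'y, 'k::zero) dpoly set" where
  "polys_in V = {f. dvars f \<subseteq> V}"

definition deg_in :: "('d, 'y) dvar \<Rightarrow> ('d, 'y, 'k::zero) dpoly \<Rightarrow> nat" where
  "deg_in u f = Max (insert 0 ((\<lambda>m. Poly_Mapping.lookup m u) ` Poly_Mapping.keys f))"

text \<open>The coefficient of \<open>u\<^sup>d\<close> in \<open>f\<close>, for \<open>f\<close> viewed as a univariate polynomial in \<open>u\<close>.\<close>

definition coeff_in ::
    "('d, 'y) dvar \<Rightarrow> nat \<Rightarrow> ('d, 'y, 'k::comm_monoid_add) dpoly \<Rightarrow> ('d, 'y, 'k) dpoly" where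
  "coeff_in u d f =
     (\<Sum>m\<in>{m \<in> Poly_Mapping.keys f. Poly_Mapping.lookup m u = d}.
        Poly_Mapping.single (m - Poly_Mapping.single u d) (Poly_Mapping.lookup f m))"

text \<open>
  The formal partial derivative. The subtraction of exponents is truncated, but this only
  affects power products without \<open>u\<close>, whose contribution has coefficient 0.
\<close>

definition partial_deriv ::
    "('d, 'y) dvar \<Rightarrow> ('d, 'y, 'k::comm_semiring_1) dpoly \<Rightarrow> ('d, 'y, 'k) dpoly" where
  "partial_deriv u f =
     (\<Sum>m\<in>Poly_Mapping.keys f.
        Poly_Mapping.single (m - Poly_Mapping.single u 1)
          (of_nat (Poly_Mapping.lookup m u) * Poly_Mapping.lookup f m))"

text \<open>
  The derivation on differential polynomials: the unique derivation that restricts to \<open>der i\<close>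
  on the coefficients and maps \<open>\<theta> y\<^sub>j\<close> to \<open>\<delta>\<^sub>i \<theta> y\<^sub>j\<close>, written out by the chain rule.
\<close>

definition total_deriv ::
    "('d \<Rightarrow> 'k::comm_ring_1 \<Rightarrow> 'k) \<Rightarrow> 'd \<Rightarrow> ('d, 'y, 'k) dpoly \<Rightarrow> ('d, 'y, 'k) dpoly" where
  "total_deriv der i f =
     Poly_Mapping.map (der i) f +
     (\<Sum>u\<in>dvars f. partial_deriv u f * var_dpoly (apply_op (Poly_Mapping.single i 1) u))"

definition differential_ideal ::
    "('d \<Rightarrow> 'k::comm_ring_1 \<Rightarrow> 'k) \<Rightarrow> ('d, 'y, 'k) dpoly set \<Rightarrow> bool" where
  "differential_ideal der J \<longleftrightarrow>
     0 \<in> J \<and> (\<forall>f\<in>J. \<forall>g\<in>J. f + g \<in> J) \<and> (\<forall>f\<in>J. \<forall>h. h * f \<in> J) \<and>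
     (\<forall>f\<in>J. \<forall>i. total_deriv der i f \<in> J)"

definition generated_differential_ideal ::
    "('d \<Rightarrow> 'k::comm_ring_1 \<Rightarrow> 'k) \<Rightarrow> ('d, 'y, 'k) dpoly set \<Rightarrow> ('d, 'y, 'k) dpoly set" where
  "generated_differential_ideal der F = \<Inter>{J. differential_ideal der J \<and> F \<subseteq> J}"

definition saturation ::
    "('d, 'y, 'k::comm_ring_1) dpoly set \<Rightarrow> ('d, 'y, 'k) dpoly \<Rightarrow> ('d, 'y, 'k) dpoly set" where
  "saturation J h = {a. \<exists>m::nat. h ^ m * a \<in> J}"

text \<open>A ranking is a relation \<open>R\<close> in which \<open>(u, v) \<in> R\<close> means \<open>u \<le> v\<close>.\<close>

definition ranking :: "(('d, 'y) dvar) rel \<Rightarrow> bool" where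
  "ranking R \<longleftrightarrow>
     linear_order R \<and>
     (\<forall>\<theta> u. (u, apply_op \<theta> u) \<in> R) \<and>
     (\<forall>\<theta> u v. (v, u) \<in> R \<longrightarrow> (apply_op \<theta> v, apply_op \<theta> u) \<in> R)"

definition leader :: "(('d, 'y) dvar) rel \<Rightarrow> ('d, 'y, 'k::zero) dpoly \<Rightarrow> ('d, 'y) dvar" where
  "leader R f = (THE u. u \<in> dvars f \<and> (\<forall>w\<in>dvars f. (w, u) \<in> R))"

definition initial_of ::
    "(('d, 'y) dvar) rel \<Rightarrow> ('d, 'y, 'k::comm_ring_1) dpoly \<Rightarrow> ('d, 'y, 'k) dpoly" where
  "initial_of R f = coeff_in (leader R f) (deg_in (leader R f) f) f"

definition separant_of ::
    "(('d, 'y) dvar) rel \<Rightarrow> ('d, 'y, 'k::comm_ring_1) dpoly \<Rightarrow> ('d, 'y, 'k) dpoly" where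
  "separant_of R f = partial_deriv (leader R f) f"

text \<open>The rank \<open>u\<^sup>d\<close> is encoded as the pair \<open>(u, d)\<close>.\<close>

definition rank_of :: "(('d, 'y) dvar) rel \<Rightarrow> ('d, 'y, 'k::zero) dpoly \<Rightarrow> ('d, 'y) dvar \<times> nat" where
  "rank_of R f = (leader R f, deg_in (leader R f) f)"

definition rank_less ::
    "(('d, 'y) dvar) rel \<Rightarrow> ('d, 'y) dvar \<times> nat \<Rightarrow> ('d, 'y) dvar \<times> nat \<Rightarrow> bool" where
  "rank_less R p q \<longleftrightarrow>
     ((fst p, fst q) \<in> R \<and> fst p \<noteq> fst q) \<or> (fst p = fst q \<and> snd p < snd q)"

definition reduced_wrt ::
    "(('d, 'y) dvar) rel \<Rightarrow> ('d, 'y, 'k::zero) dpoly \<Rightarrow> ('d, 'y, 'k) dpoly \<Rightarrow> bool" where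
  "reduced_wrt R f g \<longleftrightarrow>
     (\<forall>\<theta>. \<theta> \<noteq> 0 \<longrightarrow> apply_op \<theta> (leader R g) \<notin> dvars f) \<and>
     deg_in (leader R g) f < deg_in (leader R g) g"

definition autoreduced :: "(('d, 'y) dvar) rel \<Rightarrow> ('d, 'y, 'k::zero) dpoly set \<Rightarrow> bool" where
  "autoreduced R A \<longleftrightarrow>
     A \<inter> range const_dpoly = {} \<and> (\<forall>f\<in>A. \<forall>g\<in>A. f \<noteq> g \<longrightarrow> reduced_wrt R f g)"

text \<open>
  Autoreduced sets are finite and their elements have pairwise distinct ranks,
  so each is represented by the list of its elements in order of increasing rank.
\<close>

definition autoreduced_seq :: "(('d, 'y) dvar) rel \<Rightarrow> ('d, 'y, 'k::zero) dpoly list \<Rightarrow> bool" where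
  "autoreduced_seq R As \<longleftrightarrow>
     autoreduced R (set As) \<and>
     sorted_wrt (\<lambda>f g. rank_less R (rank_of R f) (rank_of R g)) As"

definition lower_rank ::
    "(('d, 'y) dvar) rel \<Rightarrow> ('d, 'y, 'k::zero) dpoly list \<Rightarrow> ('d, 'y, 'k) dpoly list \<Rightarrow> bool" where
  "lower_rank R As Bs \<longleftrightarrow>
     (\<exists>j. j < length As \<and> j < length Bs \<and>
        (\<forall>i<j. rank_of R (As ! i) = rank_of R (Bs ! i)) \<and>
        rank_less R (rank_of R (As ! j)) (rank_of R (Bs ! j))) \<or>
     (length As > length Bs \<and>
        (\<forall>i<length Bs. rank_of R (As ! i) = rank_of R (Bs ! i)))"

definition characteristic_set ::
    "(('d, 'y) dvar) rel \<Rightarrow> ('d, 'y, 'k::zero) dpoly set \<Rightarrow> ('d, 'y, 'k) dpoly list \<Rightarrow> bool" where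
  "characteristic_set R J As \<longleftrightarrow>
     autoreduced_seq R As \<and> set As \<subseteq> J \<and>
     (\<forall>Bs. autoreduced_seq R Bs \<and> set Bs \<subseteq> J \<longrightarrow> \<not> lower_rank R Bs As)"

definition H_prod ::
    "(('d, 'y) dvar) rel \<Rightarrow> ('d, 'y, 'k::comm_ring_1) dpoly list \<Rightarrow> ('d, 'y, 'k) dpoly" where
  "H_prod R As = (\<Prod>f\<leftarrow>As. initial_of R f * separant_of R f)"

definition characterizable ::
    "('d \<Rightarrow> 'k::comm_ring_1 \<Rightarrow> 'k) \<Rightarrow> (('d, 'y) dvar) rel \<Rightarrow> ('d, 'y, 'k) dpoly set \<Rightarrow> bool" where
  "characterizable der R J \<longleftrightarrow>
     differential_ideal der J \<and>
     (\<exists>As. characteristic_set R J As \<and>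
        J = saturation (generated_differential_ideal der (set As)) (H_prod R As))"

text \<open>
  All characteristic sets of an ideal have the same leaders, so the non-leaders of the ideal
  can be computed from any one characteristic set \<open>As\<close>.
\<close>

definition nonleaders ::
    "(('d, 'y) dvar) rel \<Rightarrow> ('d, 'y, 'k::zero) dpoly list \<Rightarrow> ('d, 'y) dvar set" where
  "nonleaders R As = - {apply_op \<theta> (leader R f) |\<theta> f. f \<in> set As}"

text \<open>
  The lexicographic order compares exponents at the highest differential variable
  in which two power products differ.
\<close>

definition lex_less :: "(('d, 'y) dvar) rel \<Rightarrow> ('d, 'y) pprod \<Rightarrow> ('d, 'y) pprod \<Rightarrow> bool" where
  "lex_less R s t \<longleftrightarrow>
     (\<exists>u. Poly_Mapping.lookup s u < Poly_Mapping.lookup t u \<and>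
        (\<forall>w. (u, w) \<in> R \<and> w \<noteq> u \<longrightarrow> Poly_Mapping.lookup s w = Poly_Mapping.lookup t w))"

definition lex_leading_pprod :: "(('d, 'y) dvar) rel \<Rightarrow> ('d, 'y, 'k::zero) dpoly \<Rightarrow> ('d, 'y) pprod" where
  "lex_leading_pprod R f =
     (THE m. m \<in> Poly_Mapping.keys f \<and>
        (\<forall>m'\<in>Poly_Mapping.keys f. m' \<noteq> m \<longrightarrow> lex_less R m' m))"

definition lex_leading_coeff :: "(('d, 'y) dvar) rel \<Rightarrow> ('d, 'y, 'k::zero) dpoly \<Rightarrow> 'k" where
  "lex_leading_coeff R f = Poly_Mapping.lookup f (lex_leading_pprod R f)"

definition canonical_characteristic_set ::
    "(('d, 'y) dvar) rel \<Rightarrow> ('d, 'y, 'k::comm_ring_1) dpoly set \<Rightarrow> ('d, 'y, 'k) dpoly list \<Rightarrow> bool" where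
  "canonical_characteristic_set R J Cs \<longleftrightarrow>
     characteristic_set R J Cs \<and>
     (\<forall>C\<in>set Cs. initial_of R C \<in> polys_in (nonleaders R Cs)) \<and>
     (\<forall>C\<in>set Cs.
        (\<forall>g\<in>polys_in (nonleaders R Cs). g dvd C \<longrightarrow> g \<in> range const_dpoly) \<and>
        lex_leading_coeff R (initial_of R C) = 1)"

end

theory Submission
  imports Defs
    "HOL-Computational_Algebra.Polynomial"
begin

text \<open>
  Let \<open>C\<close> be an element of the canonical characteristic set, with leader \<open>u\<close>, degree \<open>d\<close> in \<open>u\<close> and
  initial \<open>a\<close>, and suppose that \<open>D = \<partial>C/\<partial>v\<close> lies in \<open>I\<close>. The only element of \<open>I\<close> that is reduced
  with respect to the characteristic set is 0, because \<open>I\<close> contains no nonzero constant.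
  Since \<open>D \<noteq> 0\<close>, its degree in \<open>u\<close> must be \<open>d\<close>, so \<open>v \<noteq> u\<close> and \<open>b = \<partial>a/\<partial>v \<noteq> 0\<close>.
  As \<open>a\<close> and \<open>b\<close> involve only non-leaders, \<open>a D - b C\<close> is reduced and hence 0. By unique
  factorization \<open>a\<close> splits as \<open>a\<^sub>1 a\<^sub>2\<close> with \<open>a\<^sub>1\<close> dividing \<open>b\<close> and \<open>a\<^sub>2\<close> dividing \<open>C\<close>; canonicity
  makes \<open>a\<^sub>2\<close> constant, so \<open>a\<close> divides \<open>b\<close>, which has smaller degree in \<open>v\<close>.

  If a characterizable ideal were the unit ideal, its defining characteristic set would consist of
  linear polynomials \<open>a\<^sub>j y\<^sub>j + b\<^sub>j\<close> with constant coefficients. Evaluating \<open>\<theta> y\<^sub>j\<close> at \<open>\<theta> (- b\<^sub>j / a\<^sub>j)\<close>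
  is then a differential homomorphism that kills these polynomials but not their initials and
  separants.
\<close>

section \<open>Differential polynomials as polynomials in one variable\<close>

text \<open>The step demands no fresh key, so an additive or biadditive identity, such as
  multiplicativity of \<open>upoly\<close> or \<open>eval_dpoly\<close>, only has to be checked on
  single terms.\<close>

lemma poly_mapping_add_single_induct [case_names zero add]:
  assumes "P 0" and "\<And>a b f. P f \<Longrightarrow> P (Poly_Mapping.single a b + f)"
  shows "P (f :: 'a \<Rightarrow>\<^sub>0 'b::comm_monoid_add)"
proof (induction f rule: Poly_Mapping.update_induct)
  case const
  show ?case by (rule assms(1))
next
  case (update f a b)
  have "Poly_Mapping.update a b f = Poly_Mapping.single a b + f"
    using update(1)
    by (intro poly_mapping_eqI)
      (auto simp: lookup_update lookup_add lookup_single when_def in_keys_iff)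
  then show ?case using assms(2)[OF update(3)] by simp
qed

lemma minus_single_add_single:
  fixes m :: "'a \<Rightarrow>\<^sub>0 nat"
  assumes "d \<le> Poly_Mapping.lookup m u"
  shows "m - Poly_Mapping.single u d + Poly_Mapping.single u d = m"
  using assms
  by (intro poly_mapping_eqI) (auto simp: lookup_add lookup_minus lookup_single when_def)

lemma minus_single_eq_iff:
  fixes m :: "'a \<Rightarrow>\<^sub>0 nat"
  assumes "d \<le> Poly_Mapping.lookup m u"
  shows "m - Poly_Mapping.single u d = m' \<longleftrightarrow> m = m' + Poly_Mapping.single u d"
  using minus_single_add_single[OF assms] by auto

text \<open>Dividing by \<open>u\<close> to the power \<open>d\<close> is injective on the power
  products whose exponent in \<open>u\<close> is exactly \<open>d\<close>, so at most one summand
  contributes to the coefficient at \<open>m\<close>.\<close>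

lemma lookup_coeff_in:
  fixes f :: "('d, 'y, 'k::comm_monoid_add) dpoly"
  shows "Poly_Mapping.lookup (coeff_in u d f) m =
     (if Poly_Mapping.lookup m u = 0 then Poly_Mapping.lookup f (m + Poly_Mapping.single u d) else 0)"
proof -
  let ?K = "{m \<in> Poly_Mapping.keys f. Poly_Mapping.lookup m u = d}"
  have eq: "m' - Poly_Mapping.single u d = m \<longleftrightarrow>
      m' = m + Poly_Mapping.single u d \<and> Poly_Mapping.lookup m u = 0"
    if "Poly_Mapping.lookup m' u = d" for m' :: "('d, 'y) pprod"
    using that minus_single_eq_iff[of d m' u m] by (auto simp: lookup_add lookup_minus)
  have "Poly_Mapping.lookup (coeff_in u d f) m =
      (\<Sum>m'\<in>?K. Poly_Mapping.lookup f m' when m' - Poly_Mapping.single u d = m)"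
    by (simp add: coeff_in_def lookup_sum lookup_single)
  also have "\<dots> = (\<Sum>m'\<in>?K. if m' = m + Poly_Mapping.single u d
      then (if Poly_Mapping.lookup m u = 0 then Poly_Mapping.lookup f m' else 0) else 0)"
    by (intro sum.cong refl) (auto simp: eq when_def)
  also have "\<dots> = (if Poly_Mapping.lookup m u = 0
      then Poly_Mapping.lookup f (m + Poly_Mapping.single u d) else 0)"
    by (subst sum.delta) (auto simp: lookup_add in_keys_iff)
  finally show ?thesis .
qed

text \<open>Truncated subtraction does no harm: where the exponent of \<open>u\<close> is 0 the
  summand carries the factor 0, and elsewhere the subtraction can be undone.\<close>

lemma lookup_partial_deriv:
  fixes f :: "('d, 'y, 'k::comm_semiring_1) dpoly"
  shows "Poly_Mapping.lookup (partial_deriv u f) m =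
     of_nat (Poly_Mapping.lookup m u + 1) * Poly_Mapping.lookup f (m + Poly_Mapping.single u 1)"
proof -
  have eq: "(of_nat (Poly_Mapping.lookup m' u) * c when m' - Poly_Mapping.single u 1 = m) =
      (if m' = m + Poly_Mapping.single u 1 then of_nat (Poly_Mapping.lookup m' u) * c else 0)"
    for m' :: "('d, 'y) pprod" and c :: 'k
  proof (cases "Poly_Mapping.lookup m' u = 0")
    case False
    then have "m' - Poly_Mapping.single u 1 = m \<longleftrightarrow> m' = m + Poly_Mapping.single u 1"
      by (intro minus_single_eq_iff) simp
    then show ?thesis by (simp add: when_def)
  qed (auto simp: lookup_add)
  have "Poly_Mapping.lookup (partial_deriv u f) m = (\<Sum>m'\<in>Poly_Mapping.keys f.
      of_nat (Poly_Mapping.lookup m' u) * Poly_Mapping.lookup f m'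
        when m' - Poly_Mapping.single u 1 = m)"
    by (simp add: partial_deriv_def lookup_sum lookup_single)
  also have "\<dots> = of_nat (Poly_Mapping.lookup m u + 1) *
      Poly_Mapping.lookup f (m + Poly_Mapping.single u 1)"
    unfolding eq by (subst sum.delta) (auto simp: in_keys_iff lookup_add)
  finally show ?thesis .
qed

section \<open>Variables occurring in a polynomial\<close>

lemma finite_dvars [simp]: "finite (dvars f)"
  by (simp add: dvars_def)

lemma in_dvars_iff: "u \<in> dvars f \<longleftrightarrow> (\<exists>m\<in>Poly_Mapping.keys f. Poly_Mapping.lookup m u \<noteq> 0)"
  by (simp add: dvars_def in_keys_iff)

lemma in_dvarsI:
  "m \<in> Poly_Mapping.keys f \<Longrightarrow> Poly_Mapping.lookup m u \<noteq> 0 \<Longrightarrow> u \<in> dvars f"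
  by (auto simp: in_dvars_iff)

lemma dvars_zero [simp]: "dvars 0 = {}"
  by (simp add: dvars_def)

lemma dvars_const [simp]: "dvars (const_dpoly c) = {}"
  by (simp add: dvars_def const_dpoly_def)

lemma dvars_one [simp]: "dvars 1 = {}"
  by (simp add: dvars_def)

lemma dvars_var [simp]:
  "dvars (var_dpoly u :: ('d, 'y, 'k::zero_neq_one) dpoly) = {u}"
  by (simp add: dvars_def var_dpoly_def)

lemma dvars_uminus [simp]: "dvars (- f :: ('d, 'y, 'k::ab_group_add) dpoly) = dvars f"
  by (simp add: dvars_def in_keys_iff set_eq_iff)

lemma dvars_add: "dvars (f + g) \<subseteq> dvars f \<union> dvars g"
  using keys_add[of f g] by (auto simp: dvars_def)

lemma dvars_diff:
  "dvars (f - g :: ('d, 'y, 'k::ab_group_add) dpoly) \<subseteq> dvars f \<union> dvars g"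
  using dvars_add[of f "- g"] by simp

lemma dvars_mult: "dvars (f * g) \<subseteq> dvars f \<union> dvars g"
proof
  fix u assume "u \<in> dvars (f * g)"
  then obtain m where "m \<in> Poly_Mapping.keys (f * g)" "Poly_Mapping.lookup m u \<noteq> 0"
    by (auto simp: in_dvars_iff)
  moreover obtain a b where "m = a + b" "a \<in> Poly_Mapping.keys f" "b \<in> Poly_Mapping.keys g"
    using keys_mult[of f g] calculation(1) by blast
  ultimately show "u \<in> dvars f \<union> dvars g"
    by (auto simp: in_dvars_iff lookup_add)
qed

lemma dvars_coeff_in: "dvars (coeff_in u d f) \<subseteq> dvars f - {u}"
proof
  fix w assume "w \<in> dvars (coeff_in u d f)"
  then obtain m where m: "Poly_Mapping.lookup (coeff_in u d f) m \<noteq> 0" "Poly_Mapping.lookup m w \<noteq> 0"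
    unfolding in_dvars_iff in_keys_iff by blast
  then have "Poly_Mapping.lookup m u = 0" "m + Poly_Mapping.single u d \<in> Poly_Mapping.keys f"
    unfolding in_keys_iff by (auto simp: lookup_coeff_in split: if_splits)
  then show "w \<in> dvars f - {u}"
    using m(2) in_dvarsI[of "m + Poly_Mapping.single u d" f w] by (auto simp: lookup_add)
qed

lemma dvars_partial_deriv: "dvars (partial_deriv u f) \<subseteq> dvars f"
proof
  fix w assume "w \<in> dvars (partial_deriv u f)"
  then obtain m where m: "Poly_Mapping.lookup (partial_deriv u f) m \<noteq> 0" "Poly_Mapping.lookup m w \<noteq> 0"
    unfolding in_dvars_iff in_keys_iff by blast
  then have "m + Poly_Mapping.single u 1 \<in> Poly_Mapping.keys f"
    unfolding in_keys_iff by (auto simp: lookup_partial_deriv)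
  then show "w \<in> dvars f"
    using m(2) in_dvarsI[of "m + Poly_Mapping.single u 1" f w] by (auto simp: lookup_add)
qed

lemma dvars_empty_iff: "dvars f = {} \<longleftrightarrow> f \<in> range const_dpoly"
proof
  assume "dvars f = {}"
  then have "m = 0" if "m \<in> Poly_Mapping.keys f" for m
    using that by (auto simp: dvars_def)
  then have "f = const_dpoly (Poly_Mapping.lookup f 0)"
    by (intro poly_mapping_eqI) (auto simp: const_dpoly_def lookup_single when_def in_keys_iff)
  then show "f \<in> range const_dpoly" by blast
qed auto

lemma const_dpoly_mult: "const_dpoly (a * b) = const_dpoly a * const_dpoly b"
  by (simp add: const_dpoly_def mult_single)

lemma const_dpoly_one [simp]: "const_dpoly 1 = 1"
  by (simp add: const_dpoly_def)

lemma const_dpoly_zero [simp]: "const_dpoly 0 = 0"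
  by (simp add: const_dpoly_def)

lemma const_dpoly_eq_0_iff [simp]: "const_dpoly c = 0 \<longleftrightarrow> c = 0"
  by (metis const_dpoly_def lookup_single_eq lookup_zero single_zero)

section \<open>Degrees and coefficients with respect to one variable\<close>

lemma deg_in_le_iff:
  "deg_in u f \<le> n \<longleftrightarrow> (\<forall>m\<in>Poly_Mapping.keys f. Poly_Mapping.lookup m u \<le> n)"
  by (simp add: deg_in_def)

lemma lookup_le_deg_in: "m \<in> Poly_Mapping.keys f \<Longrightarrow> Poly_Mapping.lookup m u \<le> deg_in u f"
  using deg_in_le_iff by blast

lemma deg_in_eq_0_iff: "deg_in u f = 0 \<longleftrightarrow> u \<notin> dvars f"
  using deg_in_le_iff[of u f 0] by (auto simp: in_dvars_iff)

lemma coeff_in_eq_0: "deg_in u f < d \<Longrightarrow> coeff_in u d f = 0"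
proof (rule poly_mapping_eqI)
  fix m
  assume "deg_in u f < d"
  then show "Poly_Mapping.lookup (coeff_in u d f) m = Poly_Mapping.lookup 0 m"
    using lookup_le_deg_in[of "m + Poly_Mapping.single u d" f u]
    by (auto simp: lookup_coeff_in in_keys_iff lookup_add)
qed

lemma coeff_in_nonzero_exists:
  assumes "m \<in> Poly_Mapping.keys f"
  shows "coeff_in u (Poly_Mapping.lookup m u) f \<noteq> 0"
proof -
  let ?m = "m - Poly_Mapping.single u (Poly_Mapping.lookup m u)"
  have "?m + Poly_Mapping.single u (Poly_Mapping.lookup m u) = m"
    by (rule minus_single_add_single) simp
  then have "Poly_Mapping.lookup (coeff_in u (Poly_Mapping.lookup m u) f) ?m = Poly_Mapping.lookup f m"
    by (simp add: lookup_coeff_in lookup_minus)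
  then show ?thesis using assms by (auto simp: in_keys_iff)
qed

lemma coeff_in_deg_in_nonzero:
  assumes "f \<noteq> 0"
  shows "coeff_in u (deg_in u f) f \<noteq> 0"
proof -
  have ne: "Poly_Mapping.keys f \<noteq> {}" using assms by simp
  \<comment> \<open>The default 0 in \<open>deg_in\<close> exceeds no exponent, so for nonzero
    \<open>f\<close> the maximum is attained at a power product of \<open>f\<close>.\<close>
  have "deg_in u f = Max ((\<lambda>m. Poly_Mapping.lookup m u) ` Poly_Mapping.keys f)"
    using ne by (simp add: deg_in_def)
  also have "\<dots> \<in> (\<lambda>m. Poly_Mapping.lookup m u) ` Poly_Mapping.keys f"
    using ne by (intro Max_in) auto
  finally obtain m where "m \<in> Poly_Mapping.keys f" "deg_in u f = Poly_Mapping.lookup m u"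
    by blast
  then show ?thesis using coeff_in_nonzero_exists[of m f u] by simp
qed

lemma coeff_in_add: "coeff_in u d (f + g) = coeff_in u d f + coeff_in u d g"
  by (intro poly_mapping_eqI) (simp add: lookup_coeff_in lookup_add)

lemma coeff_in_zero [simp]: "coeff_in u d 0 = 0"
  by (simp add: coeff_in_def)

text \<open>The embedding into univariate polynomials in \<open>u\<close>, with coefficients that
  are again differential polynomials but free of \<open>u\<close>. It transfers facts about degrees
  and products from type \<open>poly\<close>.\<close>

definition upoly :: "('d, 'y) dvar \<Rightarrow> ('d, 'y, 'k::comm_monoid_add) dpoly \<Rightarrow> ('d, 'y, 'k) dpoly poly" where
  "upoly u f = (\<Sum>d\<le>deg_in u f. monom (coeff_in u d f) d)"

lemma coeff_upoly [simp]: "coeff (upoly u f) d = coeff_in u d f"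
  by (simp add: upoly_def coeff_sum coeff_in_eq_0)

lemma upoly_add: "upoly u (f + g) = upoly u f + upoly u g"
  by (simp add: poly_eq_iff coeff_in_add)

lemma upoly_0 [simp]: "upoly u 0 = 0"
  by (simp add: poly_eq_iff)

lemma degree_upoly: "degree (upoly u f) = deg_in u f"
proof (cases "f = 0")
  case True
  then show ?thesis by (simp add: deg_in_def)
next
  case False
  then have "deg_in u f \<le> degree (upoly u f)"
    by (intro le_degree) (simp add: coeff_in_deg_in_nonzero)
  moreover have "degree (upoly u f) \<le> deg_in u f"
    by (intro degree_le) (simp add: coeff_in_eq_0)
  ultimately show ?thesis by simp
qed

lemma upoly_single:
  "upoly u (Poly_Mapping.single m c) =
     monom (Poly_Mapping.single (m - Poly_Mapping.single u (Poly_Mapping.lookup m u)) c)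
       (Poly_Mapping.lookup m u)"
proof -
  have *: "m' + Poly_Mapping.single u d = m \<and> Poly_Mapping.lookup m' u = 0 \<longleftrightarrow>
      d = Poly_Mapping.lookup m u \<and> m - Poly_Mapping.single u (Poly_Mapping.lookup m u) = m'" for m' d
  proof (intro iffI; elim conjE)
    assume "m' + Poly_Mapping.single u d = m" "Poly_Mapping.lookup m' u = 0"
    then show "d = Poly_Mapping.lookup m u \<and> m - Poly_Mapping.single u (Poly_Mapping.lookup m u) = m'"
      by (auto simp: lookup_add)
  next
    assume "d = Poly_Mapping.lookup m u" "m - Poly_Mapping.single u (Poly_Mapping.lookup m u) = m'"
    then show "m' + Poly_Mapping.single u d = m \<and> Poly_Mapping.lookup m' u = 0"
      using minus_single_add_single[of "Poly_Mapping.lookup m u" m u] by (auto simp: lookup_minus)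
  qed
  have "Poly_Mapping.lookup (coeff_in u d (Poly_Mapping.single m c)) m' =
      (c when (m' + Poly_Mapping.single u d = m \<and> Poly_Mapping.lookup m' u = 0))" for m' d
    by (auto simp: lookup_coeff_in lookup_single when_def)
  also have "\<dots> m' d = Poly_Mapping.lookup (coeff (monom (Poly_Mapping.single (m -
      Poly_Mapping.single u (Poly_Mapping.lookup m u)) c) (Poly_Mapping.lookup m u)) d) m'" for m' d
    unfolding * by (auto simp: lookup_single when_def)
  finally show ?thesis by (intro poly_eqI poly_mapping_eqI) simp
qed

text \<open>Both sides are biadditive, and on single terms the exponents of \<open>u\<close> and the
  remaining power products add separately.\<close>

lemma upoly_mult:
  fixes f g :: "('d, 'y, 'k::comm_semiring_0) dpoly"
  shows "upoly u (f * g) = upoly u f * upoly u g"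
proof -
  have single: "upoly u (Poly_Mapping.single m c * Poly_Mapping.single n e) =
      upoly u (Poly_Mapping.single m c) * upoly u (Poly_Mapping.single n e)" for m n and c e :: 'k
  proof -
    have "m + n - Poly_Mapping.single u (Poly_Mapping.lookup (m + n) u) =
        (m - Poly_Mapping.single u (Poly_Mapping.lookup m u)) +
        (n - Poly_Mapping.single u (Poly_Mapping.lookup n u))"
      by (intro poly_mapping_eqI) (auto simp: lookup_add lookup_minus lookup_single when_def)
    then show ?thesis
      by (simp add: upoly_single mult_single mult_monom lookup_add)
  qed
  have "upoly u (Poly_Mapping.single m c * g) = upoly u (Poly_Mapping.single m c) * upoly u g" for m c
    by (induction g rule: poly_mapping_add_single_induct)
      (simp_all add: upoly_add single distrib_left)
  then show ?thesis
    by (induction f rule: poly_mapping_add_single_induct)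
      (simp_all add: upoly_add distrib_right)
qed

lemma coeff_in_mult_deg_in:
  fixes f g :: "('d, 'y, 'k::comm_semiring_0) dpoly"
  shows "coeff_in u (deg_in u f + deg_in u g) (f * g) =
    coeff_in u (deg_in u f) f * coeff_in u (deg_in u g) g"
  using coeff_mult_degree_sum[of "upoly u f" "upoly u g"]
  by (simp add: degree_upoly flip: upoly_mult)

lemma deg_in_mult_le:
  fixes f g :: "('d, 'y, 'k::comm_semiring_0) dpoly"
  shows "deg_in u (f * g) \<le> deg_in u f + deg_in u g"
  by (metis degree_mult_le degree_upoly upoly_mult)

lemma upoly_free:
  assumes "u \<notin> dvars f"
  shows "upoly u f = [:f:]"
proof (rule poly_eqI)
  fix d
  have *: "Poly_Mapping.lookup f m = 0" if "Poly_Mapping.lookup m u \<noteq> 0" for m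
    using assms that in_dvarsI[of m f u] by (auto simp: in_keys_iff)
  show "coeff (upoly u f) d = coeff [:f:] d"
    by (cases d) (auto simp: lookup_coeff_in lookup_add * intro!: poly_mapping_eqI)
qed

lemma upoly_var:
  "upoly u (var_dpoly u :: ('d, 'y, 'k::comm_semiring_1) dpoly) = monom 1 1"
  by (simp add: var_dpoly_def upoly_single)

lemma dpoly_expand:
  fixes f :: "('d, 'y, 'k::comm_semiring_1) dpoly"
  shows "poly (upoly u f) (var_dpoly u) = f"
proof -
  have pow: "var_dpoly u ^ n = Poly_Mapping.single (Poly_Mapping.single u n) (1::'k)" for n
    by (induction n) (simp_all add: var_dpoly_def mult_single flip: single_add)
  have "(m - Poly_Mapping.single u (Poly_Mapping.lookup m u)) +
      Poly_Mapping.single u (Poly_Mapping.lookup m u) = m" for m :: "('d, 'y) pprod"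
    by (rule minus_single_add_single) simp
  then show ?thesis
    by (induction f rule: poly_mapping_add_single_induct)
      (simp_all add: upoly_add upoly_single poly_monom pow mult_single)
qed

lemma upoly_diff:
  fixes f g :: "('d, 'y, 'k::ab_group_add) dpoly"
  shows "upoly u (f - g) = upoly u f - upoly u g"
  by (metis add_diff_cancel_right' diff_add_cancel upoly_add)

section \<open>Unique factorization\<close>

lemma coeff_in_mult:
  fixes f g :: "('d, 'y, 'k::comm_semiring_0) dpoly"
  shows "coeff_in u d (f * g) = (\<Sum>i\<le>d. coeff_in u i f * coeff_in u (d - i) g)"
  using coeff_mult[of "upoly u f" "upoly u g" d] by (simp flip: upoly_mult)

lemma coeff_in_mult_free:
  fixes f g :: "('d, 'y, 'k::comm_semiring_0) dpoly"
  assumes "u \<notin> dvars f"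
  shows "coeff_in u d (f * g) = f * coeff_in u d g"
proof -
  have "coeff (upoly u (f * g)) d = coeff ([:f:] * upoly u g) d"
    by (simp only: upoly_mult upoly_free[OF assms])
  then show ?thesis by simp
qed

lemma coeff_in_diff:
  fixes f g :: "('d, 'y, 'k::ab_group_add) dpoly"
  shows "coeff_in u d (f - g) = coeff_in u d f - coeff_in u d g"
  by (intro poly_mapping_eqI) (simp add: lookup_coeff_in lookup_minus)

text \<open>Induction on a finite set of variables containing those of both factors: the leading
  coefficients in a variable \<open>w\<close> are nonzero and free of \<open>w\<close>, and their
  product is a coefficient of \<open>f * g\<close>. Without variables, only constants of a domain
  remain.\<close>

lemma dpoly_mult_eq_0_iff:
  fixes f g :: "('d, 'y, 'k::idom) dpoly"
  shows "f * g = 0 \<longleftrightarrow> f = 0 \<or> g = 0"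
proof -
  have "f * g \<noteq> 0" if "finite V" "dvars f \<subseteq> V" "dvars g \<subseteq> V" "f \<noteq> 0" "g \<noteq> 0"
    for V and f g :: "('d, 'y, 'k) dpoly"
    using that
  proof (induction V arbitrary: f g rule: finite_induct)
    case empty
    then obtain a b where "f = const_dpoly a" "g = const_dpoly b"
      using dvars_empty_iff[of f] dvars_empty_iff[of g] by auto
    then show ?case using empty by (simp flip: const_dpoly_mult)
  next
    case (insert w V)
    have "coeff_in w (deg_in w f) f * coeff_in w (deg_in w g) g \<noteq> 0"
      using insert.prems dvars_coeff_in[of w _ f] dvars_coeff_in[of w _ g]
      by (intro insert.IH coeff_in_deg_in_nonzero) blast+
    then show ?case
      using coeff_in_mult_deg_in[of w f g] by auto
  qed
  from this[of "dvars f \<union> dvars g"] show ?thesis by auto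
qed

lemma deg_in_mult:
  fixes f g :: "('d, 'y, 'k::idom) dpoly"
  assumes "f \<noteq> 0" "g \<noteq> 0"
  shows "deg_in u (f * g) = deg_in u f + deg_in u g"
proof (rule antisym[OF deg_in_mult_le])
  have "coeff_in u (deg_in u f + deg_in u g) (f * g) \<noteq> 0"
    using assms by (simp add: coeff_in_mult_deg_in dpoly_mult_eq_0_iff coeff_in_deg_in_nonzero)
  then show "deg_in u f + deg_in u g \<le> deg_in u (f * g)"
    using coeff_in_eq_0 not_le by blast
qed

lemma dvars_mult_eq:
  fixes f g :: "('d, 'y, 'k::idom) dpoly"
  assumes "f \<noteq> 0" "g \<noteq> 0"
  shows "dvars (f * g) = dvars f \<union> dvars g"
proof -
  have "u \<notin> dvars (f * g) \<longleftrightarrow> u \<notin> dvars f \<and> u \<notin> dvars g" for u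
    using deg_in_mult[OF assms, of u] by (simp flip: deg_in_eq_0_iff)
  then show ?thesis by blast
qed

lemma dpoly_mult_cancel_left:
  fixes f g h :: "('d, 'y, 'k::idom) dpoly"
  assumes "f * g = f * h" "f \<noteq> 0"
  shows "g = h"
  using assms dpoly_mult_eq_0_iff[of f "g - h"] by (simp add: right_diff_distrib)

lemma dvd_dvars:
  fixes f g :: "('d, 'y, 'k::idom) dpoly"
  assumes "f dvd g" "g \<noteq> 0"
  shows "dvars f \<subseteq> dvars g"
  using assms dvars_mult_eq by (metis Un_upper1 dvdE mult_zero_left mult_zero_right)

lemma dvd_deg_in_le:
  fixes f g :: "('d, 'y, 'k::idom) dpoly"
  assumes "f dvd g" "g \<noteq> 0"
  shows "deg_in u f \<le> deg_in u g"
  using assms deg_in_mult by (metis dvdE le_add1 mult_zero_left mult_zero_right)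

lemma unit_dpoly_iff:
  fixes f :: "('d, 'y, 'k::field) dpoly"
  shows "f dvd 1 \<longleftrightarrow> f \<noteq> 0 \<and> dvars f = {}"
proof
  assume *: "f dvd 1"
  then have "f \<noteq> 0" by auto
  then show "f \<noteq> 0 \<and> dvars f = {}" using dvd_dvars[OF *] by simp
next
  assume "f \<noteq> 0 \<and> dvars f = {}"
  then obtain c where "f = const_dpoly c" "c \<noteq> 0"
    unfolding dvars_empty_iff by auto
  then have "1 = f * const_dpoly (inverse c)"
    by (simp flip: const_dpoly_mult)
  then show "f dvd 1" by (rule dvdI)
qed

section \<open>Factorization and polynomials in a restricted set of variables\<close>

lemma zero_in_polys_in [simp]: "0 \<in> polys_in V"
  by (simp add: polys_in_def)

lemma polys_in_add: "f \<in> polys_in V \<Longrightarrow> g \<in> polys_in V \<Longrightarrow> f + g \<in> polys_in V"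
  using dvars_add[of f g] by (auto simp: polys_in_def)

lemma polys_in_diff:
  fixes f g :: "('d, 'y, 'k::ab_group_add) dpoly"
  shows "f \<in> polys_in V \<Longrightarrow> g \<in> polys_in V \<Longrightarrow> f - g \<in> polys_in V"
  using dvars_diff[of f g] by (auto simp: polys_in_def)

lemma polys_in_mult: "f \<in> polys_in V \<Longrightarrow> g \<in> polys_in V \<Longrightarrow> f * g \<in> polys_in V"
  using dvars_mult[of f g] by (auto simp: polys_in_def)

lemma polys_in_power:
  fixes f :: "('d, 'y, 'k::comm_semiring_1) dpoly"
  shows "f \<in> polys_in V \<Longrightarrow> f ^ n \<in> polys_in V"
  by (induction n) (simp_all add: polys_in_mult, simp add: polys_in_def)

lemma polys_in_dvd:
  fixes f g :: "('d, 'y, 'k::idom) dpoly"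
  shows "f dvd g \<Longrightarrow> g \<noteq> 0 \<Longrightarrow> g \<in> polys_in V \<Longrightarrow> f \<in> polys_in V"
  using dvd_dvars[of f g] by (auto simp: polys_in_def)

text \<open>The sum \<open>N\<close> of the degrees in all occurring variables is additive on
  products of nonzero polynomials and positive on nonunits, so splitting off factors
  terminates.\<close>

lemma irreducible_dpoly_factor_induct [consumes 1, case_names unit mult]:
  fixes f :: "('d, 'y, 'k::field) dpoly"
  assumes "f \<noteq> 0"
    and unit: "\<And>c. c dvd 1 \<Longrightarrow> P c"
    and mult: "\<And>p g. irreducible p \<Longrightarrow> g \<noteq> 0 \<Longrightarrow> P g \<Longrightarrow> P (p * g)"
  shows "P f"
proof -
  define N where "N f = (\<Sum>u\<in>dvars f. deg_in u f)" for f :: "('d, 'y, 'k) dpoly"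
  have N_mult: "N (f * g) = N f + N g" if "f \<noteq> 0" "g \<noteq> 0" for f g :: "('d, 'y, 'k) dpoly"
  proof -
    \<comment> \<open>The sums are extended to a common set of variables; absent variables have
      degree 0.\<close>
    have "N h = (\<Sum>u\<in>dvars f \<union> dvars g. deg_in u h)" if "dvars h \<subseteq> dvars f \<union> dvars g" for h
      unfolding N_def using that by (intro sum.mono_neutral_left) (auto simp: deg_in_eq_0_iff)
    then show ?thesis
      using that by (simp add: dvars_mult_eq deg_in_mult sum.distrib)
  qed
  have N_pos: "N f > 0" if f: "f \<noteq> 0" "\<not> f dvd 1" for f :: "('d, 'y, 'k) dpoly"
  proof -
    obtain u where "u \<in> dvars f" using f unfolding unit_dpoly_iff by blast
    then show ?thesis
      unfolding N_def using deg_in_eq_0_iff[of u f] by (intro sum_pos2[of _ u]) auto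
  qed
  have factor: "\<exists>p. irreducible p \<and> p dvd f" if "f \<noteq> 0" "\<not> f dvd 1" for f :: "('d, 'y, 'k) dpoly"
    using that
  proof (induction "N f" arbitrary: f rule: less_induct)
    case less
    show ?case
    proof (cases "irreducible f")
      case False
      then obtain a b where ab: "f = a * b" "\<not> a dvd 1" "\<not> b dvd 1"
        using less.prems by (auto simp: irreducible_def)
      then have "a \<noteq> 0" "b \<noteq> 0" using less.prems by auto
      then have "N a < N f" using N_mult N_pos ab by simp
      then show ?thesis using less.hyps[of a] ab \<open>a \<noteq> 0\<close> by (auto intro: dvd_mult2)
    qed auto
  qed
  show ?thesis using assms(1)
  proof (induction "N f" arbitrary: f rule: less_induct)
    case less
    show ?case
    proof (cases "f dvd 1")
      case False
      then obtain p g where pg: "irreducible p" "f = p * g"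
        using factor less.prems by (meson dvdE)
      then have "p \<noteq> 0" "g \<noteq> 0" "\<not> p dvd 1" using less.prems by (auto simp: irreducible_def)
      then have "P g" using less.hyps[of g] N_mult N_pos pg by simp
      then show ?thesis using mult pg \<open>g \<noteq> 0\<close> by simp
    qed (rule unit)
  qed
qed

text \<open>Primality is tested only against polynomials in \<open>V\<close>, so that variables can
  be adjoined one at a time.\<close>

definition prime_in :: "('d, 'y) dvar set \<Rightarrow> ('d, 'y, 'k::comm_semiring_1) dpoly \<Rightarrow> bool" where
  "prime_in V p \<longleftrightarrow> (\<forall>f\<in>polys_in V. \<forall>g\<in>polys_in V. p dvd f * g \<longrightarrow> p dvd f \<or> p dvd g)"

text \<open>Primal elements in the sense of Schreier domains, again relative to \<open>V\<close>.
  They take over the role of contents and greatest common divisors.\<close>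

definition primal_in :: "('d, 'y) dvar set \<Rightarrow> ('d, 'y, 'k::comm_semiring_1) dpoly \<Rightarrow> bool" where
  "primal_in V s \<longleftrightarrow> (\<forall>f\<in>polys_in V. \<forall>g\<in>polys_in V. s dvd f * g \<longrightarrow>
     (\<exists>a b. s = a * b \<and> a dvd f \<and> b dvd g))"

text \<open>Induction on the irreducible factors of \<open>s\<close>: each is prime, hence divides
  \<open>f\<close> or \<open>g\<close>, and can be cancelled there and joined to the corresponding
  part of the splitting of the rest. The factors live in \<open>V\<close>, while \<open>f\<close>
  and \<open>g\<close> may use the variables of \<open>W\<close>.\<close>

lemma primal_in_of_prime_in:
  fixes s :: "('d, 'y, 'k::field) dpoly"
  assumes "s \<noteq> 0" "s \<in> polys_in V"
    and prime: "\<And>p :: ('d, 'y, 'k) dpoly. irreducible p \<Longrightarrow> p \<in> polys_in V \<Longrightarrow> prime_in W p"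
  shows "primal_in W s"
  using assms(1,2)
proof (induction s rule: irreducible_dpoly_factor_induct)
  case (unit c)
  then show ?case
    unfolding primal_in_def by (metis dvd_trans mult.right_neutral one_dvd)
next
  case (mult p s)
  have p0: "p \<noteq> 0" using mult(1) by auto
  have ps0: "p * s \<noteq> 0" using p0 mult(2) by (simp add: dpoly_mult_eq_0_iff)
  have "p \<in> polys_in V" "s \<in> polys_in V"
    using polys_in_dvd[OF _ ps0 mult.prems] by auto
  then have prime_p: "prime_in W p" and s: "primal_in W s"
    using mult prime by auto
  have quot: "\<exists>q. f = p * q \<and> q \<in> polys_in W" if f: "p dvd f" "f \<in> polys_in W" for f
  proof -
    obtain q where "f = p * q" using f(1) by auto
    then show ?thesis
      using polys_in_dvd[of q f W] f(2) p0 by (cases "f = 0") (auto simp: dpoly_mult_eq_0_iff)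
  qed
  show ?case
    unfolding primal_in_def
  proof (intro ballI impI)
    fix f g assume fg: "f \<in> polys_in W" "g \<in> polys_in W" and dvd: "p * s dvd f * g"
    then have "p dvd f \<or> p dvd g"
      using prime_p unfolding prime_in_def by (meson dvd_mult_left)
    then show "\<exists>a b. p * s = a * b \<and> a dvd f \<and> b dvd g"
    proof
      assume "p dvd f"
      then obtain q where q: "f = p * q" "q \<in> polys_in W" using quot fg by blast
      obtain t where "f * g = p * s * t" using dvd by (elim dvdE)
      then have "p * (q * g) = p * (s * t)" unfolding q(1) by (simp only: mult_ac)
      then have "q * g = s * t" using p0 by (rule dpoly_mult_cancel_left)
      then obtain a b where "s = a * b" "a dvd q" "b dvd g"
        using s fg q unfolding primal_in_def by (metis dvd_triv_left)
      then show ?thesis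
        using q by (intro exI[of _ "p * a"] exI[of _ b]) (simp add: mult.assoc mult.left_commute mult_dvd_mono)
    next
      assume "p dvd g"
      then obtain q where q: "g = p * q" "q \<in> polys_in W" using quot fg by blast
      obtain t where "f * g = p * s * t" using dvd by (elim dvdE)
      then have "p * (f * q) = p * (s * t)" unfolding q(1) by (simp only: mult_ac)
      then have "f * q = s * t" using p0 by (rule dpoly_mult_cancel_left)
      then obtain a b where "s = a * b" "a dvd f" "b dvd q"
        using s fg q unfolding primal_in_def by (metis dvd_triv_left)
      then show ?thesis
        using q by (intro exI[of _ a] exI[of _ "p * b"]) (simp add: mult.assoc mult.left_commute mult_dvd_mono)
    qed
  qed
qed

text \<open>Multiplication by a polynomial free of \<open>w\<close> acts on each coefficient in
  \<open>w\<close> separately; conversely, \<open>f\<close> is recovered from its coefficients by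
  \<open>dpoly_expand\<close>.\<close>

lemma dvd_dpoly_iff_dvd_coeffs:
  fixes p f :: "('d, 'y, 'k::comm_semiring_1) dpoly"
  assumes "w \<notin> dvars p"
  shows "p dvd f \<longleftrightarrow> (\<forall>d. p dvd coeff_in w d f)"
proof
  assume "p dvd f"
  then show "\<forall>d. p dvd coeff_in w d f"
    by (auto simp: coeff_in_mult_free[OF assms])
next
  assume "\<forall>d. p dvd coeff_in w d f"
  then have "p dvd poly (upoly w f) (var_dpoly w)"
    unfolding poly_altdef by (intro dvd_sum) simp
  then show "p dvd f" by (simp add: dpoly_expand)
qed

section \<open>Gauss's lemma and pseudo-division\<close>

lemma coeff_in_polys_in:
  "f \<in> polys_in (insert w V) \<Longrightarrow> coeff_in w d f \<in> polys_in V"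
  using dvars_coeff_in[of w d f] by (auto simp: polys_in_def)

text \<open>Gauss's lemma: if \<open>i\<close> and \<open>j\<close> are the first indices at which
  the coefficients of \<open>f\<close> and \<open>g\<close> in \<open>w\<close> are not divisible by
  \<open>p\<close>, then modulo \<open>p\<close> the coefficient of \<open>f * g\<close> at
  \<open>i + j\<close> is the product of these two.\<close>

lemma prime_in_insert:
  fixes p :: "('d, 'y, 'k::field) dpoly"
  assumes "p \<in> polys_in V" "prime_in V p" "w \<notin> V"
  shows "prime_in (insert w V) p"
  unfolding prime_in_def
proof (intro ballI impI, rule ccontr)
  fix f g :: "('d, 'y, 'k) dpoly"
  assume f: "f \<in> polys_in (insert w V)" and g: "g \<in> polys_in (insert w V)"
    and dvd: "p dvd f * g" and neg: "\<not> (p dvd f \<or> p dvd g)"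
  have w: "w \<notin> dvars p" using assms by (auto simp: polys_in_def)
  note iff = dvd_dpoly_iff_dvd_coeffs[OF w]
  define i where "i = (LEAST i. \<not> p dvd coeff_in w i f)"
  define j where "j = (LEAST j. \<not> p dvd coeff_in w j g)"
  have i: "\<not> p dvd coeff_in w i f" "\<And>k. k < i \<Longrightarrow> p dvd coeff_in w k f"
    using LeastI_ex[of "\<lambda>k. \<not> p dvd coeff_in w k f"] not_less_Least[of _ "\<lambda>k. \<not> p dvd coeff_in w k f"]
      neg iff[of f] unfolding i_def by blast+
  have j: "\<not> p dvd coeff_in w j g" "\<And>k. k < j \<Longrightarrow> p dvd coeff_in w k g"
    using LeastI_ex[of "\<lambda>k. \<not> p dvd coeff_in w k g"] not_less_Least[of _ "\<lambda>k. \<not> p dvd coeff_in w k g"]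
      neg iff[of g] unfolding j_def by blast+
  have "p dvd (\<Sum>k\<le>i+j. coeff_in w k f * coeff_in w (i + j - k) g)"
    using dvd iff[of "f * g"] unfolding coeff_in_mult by blast
  also have "(\<Sum>k\<le>i+j. coeff_in w k f * coeff_in w (i + j - k) g) =
      coeff_in w i f * coeff_in w j g +
      (\<Sum>k\<in>{..i+j}-{i}. coeff_in w k f * coeff_in w (i + j - k) g)"
    by (subst sum.remove[of _ i]) auto
  finally have "p dvd coeff_in w i f * coeff_in w j g +
      (\<Sum>k\<in>{..i+j}-{i}. coeff_in w k f * coeff_in w (i + j - k) g)" .
  moreover have "p dvd (\<Sum>k\<in>{..i+j}-{i}. coeff_in w k f * coeff_in w (i + j - k) g)"
  proof (rule dvd_sum)
    fix k assume "k \<in> {..i+j}-{i}"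
    then have "k < i \<or> i + j - k < j" by auto
    then show "p dvd coeff_in w k f * coeff_in w (i + j - k) g"
      using i(2) j(2) by (metis dvd_mult dvd_mult2)
  qed
  ultimately have "p dvd coeff_in w i f * coeff_in w j g"
    using dvd_add_left_iff by blast
  then show False
    using assms(2) i(1) j(1) coeff_in_polys_in[OF f] coeff_in_polys_in[OF g]
    unfolding prime_in_def by blast
qed

text \<open>Multiplying \<open>f\<close> by the leading coefficient of \<open>h\<close> allows its
  leading term to be cancelled by a multiple of \<open>h\<close>. Repetition lowers the degree in
  \<open>w\<close>, and the accumulated multiplier \<open>s\<close> is free of
  \<open>w\<close>.\<close>

lemma pseudo_division:
  fixes f h :: "('d, 'y, 'k::field) dpoly"
  assumes "w \<notin> V" "h \<in> polys_in (insert w V)" "h \<noteq> 0" "f \<in> polys_in (insert w V)"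
  shows "\<exists>s q r. s \<in> polys_in V \<and> s \<noteq> 0 \<and> q \<in> polys_in (insert w V) \<and>
    r \<in> polys_in (insert w V) \<and> s * f = q * h + r \<and> (r = 0 \<or> deg_in w r < deg_in w h)"
  using assms(4)
proof (induction "deg_in w f" arbitrary: f rule: less_induct)
  case less
  define lc where "lc f = coeff_in w (deg_in w f) f" for f :: "('d, 'y, 'k) dpoly"
  have lc_in: "lc f \<in> polys_in V" if "f \<in> polys_in (insert w V)" for f
    using coeff_in_polys_in[OF that] by (simp add: lc_def)
  have mono: "g \<in> polys_in V \<Longrightarrow> g \<in> polys_in (insert w V)" for g :: "('d, 'y, 'k) dpoly"
    by (auto simp: polys_in_def)
  have free: "w \<notin> dvars g" if "g \<in> polys_in V" for g :: "('d, 'y, 'k) dpoly"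
    using that assms(1) by (auto simp: polys_in_def)
  have lh0: "lc h \<noteq> 0" by (simp add: lc_def coeff_in_deg_in_nonzero assms)
  show ?case
  proof (cases "f = 0 \<or> deg_in w f < deg_in w h")
    case True
    then show ?thesis using less.prems
      by (intro exI[of _ 1] exI[of _ 0] exI[of _ f]) (simp add: polys_in_def)
  next
    case False
    define e where "e = deg_in w f - deg_in w h"
    define x where "x = lc f * var_dpoly w ^ e"
    have x_in: "x \<in> polys_in (insert w V)"
      unfolding x_def
      by (intro polys_in_mult[OF mono[OF lc_in[OF less.prems]]] polys_in_power)
        (simp add: polys_in_def)
    \<comment> \<open>One cancellation: the coefficients of \<open>f1\<close> vanish from index
      \<open>deg_in w f\<close> upwards.\<close>
    define f1 where "f1 = lc h * f - x * h"
    have f1_in: "f1 \<in> polys_in (insert w V)"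
      unfolding f1_def using less.prems assms(2) lc_in x_in mono
      by (intro polys_in_diff polys_in_mult) auto
    have ux: "upoly w x = monom (lc f) e"
    proof -
      have "upoly w (var_dpoly w ^ n :: ('d, 'y, 'k) dpoly) = monom 1 n" for n
        by (induction n) (simp_all add: upoly_mult upoly_var mult_monom upoly_free monom_0)
      then show ?thesis
        unfolding x_def using free[OF lc_in[OF less.prems]]
        by (simp add: upoly_mult upoly_free smult_monom)
    qed
    have cx: "coeff_in w d (x * h) = (if d < e then 0 else lc f * coeff_in w (d - e) h)" for d
      by (simp flip: coeff_upoly add: upoly_mult ux coeff_monom_mult)
    have c: "coeff_in w d f1 = lc h * coeff_in w d f - (if d < e then 0 else lc f * coeff_in w (d - e) h)"
      for d
      unfolding f1_def using free[OF lc_in[OF assms(2)]]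
      by (simp add: coeff_in_diff coeff_in_mult_free cx)
    have c0: "coeff_in w d f1 = 0" if "d \<ge> deg_in w f" for d
    proof (cases "d = deg_in w f")
      case True
      then show ?thesis using False
        unfolding c by (simp add: e_def mult.commute flip: lc_def)
    next
      case neq: False
      then have "deg_in w f < d" "deg_in w h < d - e"
        using that False unfolding e_def by auto
      then show ?thesis unfolding c by (simp add: coeff_in_eq_0)
    qed
    show ?thesis
    proof (cases "f1 = 0")
      case True
      then show ?thesis using lc_in[OF assms(2)] lh0 x_in
        by (intro exI[of _ "lc h"] exI[of _ x] exI[of _ 0]) (simp add: f1_def)
    next
      case f1: False
      then have "deg_in w f1 < deg_in w f"
        using c0[of "deg_in w f1"] coeff_in_deg_in_nonzero[OF f1, of w] by force
      then obtain s q r where IH: "s \<in> polys_in V" "s \<noteq> 0" "q \<in> polys_in (insert w V)"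
        "r \<in> polys_in (insert w V)" "s * f1 = q * h + r" "r = 0 \<or> deg_in w r < deg_in w h"
        using less.hyps[OF _ f1_in] by blast
      have "(s * lc h) * f = (q + s * x) * h + r"
        using IH(5) unfolding f1_def by (simp add: algebra_simps)
      moreover have "s * lc h \<in> polys_in V" "s * lc h \<noteq> 0" "q + s * x \<in> polys_in (insert w V)"
        using IH lc_in[OF assms(2)] lh0 x_in mono
        by (auto simp: dpoly_mult_eq_0_iff intro!: polys_in_mult polys_in_add)
      ultimately show ?thesis using IH(4,6) by blast
    qed
  qed
qed

text \<open>
  Gauss's argument without a quotient field: \<open>h\<close> is an element of least degree in \<open>w\<close> of the
  ideal generated by \<open>p\<close> and \<open>f\<close>, and it divides every element of this ideal up to a factor free
  of \<open>w\<close>, which can be distributed over the factors because it is primal.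
\<close>

lemma irreducible_prime_in_insert:
  fixes p :: "('d, 'y, 'k::field) dpoly"
  assumes "w \<notin> V"
    and primal: "\<And>s :: ('d, 'y, 'k) dpoly. s \<noteq> 0 \<Longrightarrow> s \<in> polys_in V \<Longrightarrow> primal_in (insert w V) s"
    and p: "irreducible p" "p \<in> polys_in (insert w V)" "w \<in> dvars p"
  shows "prime_in (insert w V) p"
proof -
  let ?K = "polys_in (insert w V) :: ('d, 'y, 'k) dpoly set"
  have p0: "p \<noteq> 0" using p by auto
  have cancel: "p dvd f" if s: "s \<noteq> 0" "s \<in> polys_in V" and f: "f \<in> ?K" and dvd: "p dvd s * f" for s f
  proof (cases "f = 0")
    case False
    obtain q where q: "s * f = p * q" using dvd by auto
    have sf: "s * f \<noteq> 0" using s False by (simp add: dpoly_mult_eq_0_iff)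
    have "s \<in> ?K" using s by (auto simp: polys_in_def)
    then have "s * f \<in> ?K" using f by (rule polys_in_mult)
    then have "q \<in> ?K" using polys_in_dvd[of q "s * f"] sf unfolding q by simp
    then obtain a b where ab: "s = a * b" "a dvd p" "b dvd q"
      using primal[OF s] p(2) q unfolding primal_in_def by (metis dvd_triv_left)
    obtain p1 where p1: "p = a * p1" using ab(2) by (elim dvdE)
    obtain q1 where q1: "q = b * q1" using ab(3) by (elim dvdE)
    note pq = p1 q1
    \<comment> \<open>Otherwise \<open>p\<close> would divide \<open>a\<close>, hence
      \<open>s\<close>, although \<open>w\<close> occurs in \<open>p\<close> and not in
      \<open>s\<close>.\<close>
    have "\<not> p1 dvd 1"
    proof
      assume "p1 dvd 1"
      then have "p dvd a" unfolding pq(1) using mult_dvd_mono[of a a p1 1] by simp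
      then have "p dvd s" using ab by (simp add: dvd_mult2)
      then have "dvars p \<subseteq> V" using dvd_dvars s by (force simp: polys_in_def)
      then show False using p assms(1) by blast
    qed
    then have "a dvd 1" using p(1) pq(1) unfolding irreducible_def by blast
    then have "p dvd p1" unfolding pq(1) using mult_dvd_mono[of a 1 p1 p1] by simp
    moreover have "f = p1 * q1"
    proof (rule dpoly_mult_cancel_left)
      show "(a * b) * f = (a * b) * (p1 * q1)"
        using q unfolding ab pq by (simp only: mult_ac)
      show "a * b \<noteq> 0" using s ab by simp
    qed
    ultimately show ?thesis by simp
  qed simp
  show ?thesis
    unfolding prime_in_def
  proof (intro ballI impI)
    fix f g assume f: "f \<in> ?K" and g: "g \<in> ?K" and dvd: "p dvd f * g"
    \<comment> \<open>The multipliers are confined to \<open>?K\<close>, so all elements of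
      \<open>J\<close> stay within the variables for which primality is available.\<close>
    define J where "J = {a * p + b * f |a b. a \<in> ?K \<and> b \<in> ?K}"
    have one: "1 \<in> ?K" by (simp add: polys_in_def)
    have "1 * p + 0 * f \<in> J" "0 * p + 1 * f \<in> J"
      unfolding J_def using one by (blast intro: zero_in_polys_in)+
    then have pJ: "p \<in> J" and fJ: "f \<in> J" by auto
    have JK: "x \<in> ?K" if "x \<in> J" for x
      using that f p(2) by (auto simp: J_def intro!: polys_in_add polys_in_mult)
    have Jcomb: "s * x - q * y \<in> J" if xy: "x \<in> J" "y \<in> J" "s \<in> ?K" "q \<in> ?K" for x y s q
    proof -
      obtain a b c d where *: "x = a * p + b * f" "y = c * p + d * f"
        "a \<in> ?K" "b \<in> ?K" "c \<in> ?K" "d \<in> ?K"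
        using xy(1,2) unfolding J_def by blast
      have "s * x - q * y = (s * a - q * c) * p + (s * b - q * d) * f"
        unfolding * by (simp add: algebra_simps)
      moreover have "s * a - q * c \<in> ?K" "s * b - q * d \<in> ?K"
        using * xy(3,4) by (auto intro!: polys_in_diff polys_in_mult)
      ultimately show ?thesis unfolding J_def by blast
    qed
    obtain h where h: "h \<in> J" "h \<noteq> 0" and
      min: "\<And>y. y \<in> J \<Longrightarrow> y \<noteq> 0 \<Longrightarrow> deg_in w h \<le> deg_in w y"
      using ex_has_least_nat[of "\<lambda>x. x \<in> J \<and> x \<noteq> 0" p "deg_in w"] pJ p0 by blast
    \<comment> \<open>The pseudo-remainder lies in \<open>J\<close> and would have smaller degree
      than \<open>h\<close> if it were nonzero.\<close>
    have divides: "\<exists>s. s \<in> polys_in V \<and> s \<noteq> 0 \<and> (\<exists>q\<in>?K. s * x = q * h)" if x: "x \<in> J" for x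
    proof -
      obtain s q r where *: "s \<in> polys_in V" "s \<noteq> 0" "q \<in> ?K" "s * x = q * h + r"
        "r = 0 \<or> deg_in w r < deg_in w h"
        using pseudo_division[OF assms(1) JK[OF h(1)] h(2) JK[OF x]] by blast
      have "s \<in> ?K" using *(1) by (auto simp: polys_in_def)
      then have "r \<in> J" using Jcomb[OF x h(1) _ *(3), of s] *(4) by simp
      then have "r = 0" using min[of r] *(5) leD by blast
      then show ?thesis using * by auto
    qed
    obtain s q where s: "s \<in> polys_in V" "s \<noteq> 0" "q \<in> ?K" "s * p = q * h"
      using divides[OF pJ] by blast
    then obtain a b where ab: "s = a * b" "a dvd q" "b dvd h"
      using primal[OF s(2,1)] JK[OF h(1)] unfolding primal_in_def by (metis dvd_triv_left)
    obtain q1 where q1: "q = a * q1" using ab(2) by (elim dvdE)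
    obtain h1 where h1: "h = b * h1" using ab(3) by (elim dvdE)
    note qh = q1 h1
    have "p = q1 * h1"
    proof (rule dpoly_mult_cancel_left)
      show "(a * b) * p = (a * b) * (q1 * h1)"
        using s(4) unfolding ab qh by (simp only: mult_ac)
      show "a * b \<noteq> 0" using s ab by simp
    qed
    then have "q1 dvd 1 \<or> h1 dvd 1" using p(1) unfolding irreducible_def by blast
    then show "p dvd f \<or> p dvd g"
    proof
      \<comment> \<open>Here \<open>p\<close> is associated to \<open>h1\<close>, so it divides
        \<open>h\<close> and thereby \<open>f\<close> up to a cancellable factor.\<close>
      assume "q1 dvd 1"
      then have "p dvd h1" unfolding \<open>p = q1 * h1\<close> using mult_dvd_mono[of q1 1 h1 h1] by simp
      then have "p dvd h" unfolding qh by simp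
      obtain s' where s': "s' \<in> polys_in V" "s' \<noteq> 0" "h dvd s' * f"
        using divides[OF fJ] by auto
      then have "p dvd s' * f" using \<open>p dvd h\<close> dvd_trans by blast
      then show ?thesis using cancel[OF s'(2,1) f] by blast
    next
      \<comment> \<open>Here \<open>h\<close> is associated to \<open>b\<close>, which is free of
        \<open>w\<close>; as \<open>p\<close> divides \<open>h * g\<close>, it divides
        \<open>b * g\<close>, and \<open>b\<close> can be cancelled.\<close>
      assume "h1 dvd 1"
      obtain c d where "h = c * p + d * f" using h(1) unfolding J_def by blast
      then have "h * g = p * (c * g) + d * (f * g)" by (simp add: algebra_simps)
      then have "p dvd h * g" using dvd by simp
      also have "h * g dvd b * g"
        unfolding qh using \<open>h1 dvd 1\<close> mult_dvd_mono[of h1 1 "b * g" "b * g"] by (simp add: mult_ac)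
      finally have "p dvd b * g" .
      moreover have "b \<noteq> 0" "b \<in> polys_in V"
        using ab(1) s(1,2) polys_in_dvd[of b s V] by auto
      ultimately show ?thesis using cancel g by blast
    qed
  qed
qed

text \<open>The form of unique factorization used below. Irreducible polynomials are shown to be
  prime by induction on the set of variables: if the new variable occurs in \<open>p\<close>, the
  ideal argument applies, and otherwise Gauss's lemma.\<close>

lemma dpoly_primal:
  fixes a f g :: "('d, 'y, 'k::field) dpoly"
  assumes "a \<noteq> 0" "a dvd f * g"
  shows "\<exists>b c. a = b * c \<and> b dvd f \<and> c dvd g"
proof -
  have prime: "prime_in V p" if "finite V" "irreducible p" "p \<in> polys_in V"
    for V and p :: "('d, 'y, 'k) dpoly"
    using that
  proof (induction V arbitrary: p rule: finite_induct)
    case empty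
    \<comment> \<open>This case is vacuous: a polynomial without variables is 0 or a unit, hence not
      irreducible.\<close>
    then show ?case by (auto simp: polys_in_def irreducible_def unit_dpoly_iff)
  next
    case (insert w V)
    show ?case
    proof (cases "w \<in> dvars p")
      case True
      show ?thesis
      proof (rule irreducible_prime_in_insert[OF insert.hyps(2) _ insert.prems True])
        fix s :: "('d, 'y, 'k) dpoly" assume "s \<noteq> 0" "s \<in> polys_in V"
        then show "primal_in (insert w V) s"
          using insert.IH insert.hyps(2) by (intro primal_in_of_prime_in prime_in_insert) auto
      qed
    next
      case False
      then have "p \<in> polys_in V" using insert.prems by (auto simp: polys_in_def)
      then show ?thesis using insert by (intro prime_in_insert) auto
    qed
  qed
  let ?V = "dvars a \<union> dvars f \<union> dvars g"
  have "primal_in ?V a"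
  proof (rule primal_in_of_prime_in[OF assms(1), of ?V])
    show "a \<in> polys_in ?V" by (auto simp: polys_in_def)
  qed (simp add: prime)
  then show ?thesis using assms(2) unfolding primal_in_def by (auto simp: polys_in_def)
qed

section \<open>Reduced elements of an ideal\<close>

lemma key_partial_deriv:
  "m \<in> Poly_Mapping.keys (partial_deriv u f) \<Longrightarrow> m + Poly_Mapping.single u 1 \<in> Poly_Mapping.keys f"
  by (auto simp: in_keys_iff lookup_partial_deriv)

lemma deg_in_partial_deriv_le:
  fixes f :: "('d, 'y, 'k::comm_semiring_1) dpoly"
  shows "deg_in w (partial_deriv u f) \<le> deg_in w f"
  unfolding deg_in_le_iff
proof
  fix m assume "m \<in> Poly_Mapping.keys (partial_deriv u f)"
  from lookup_le_deg_in[OF key_partial_deriv[OF this], of w]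
  show "Poly_Mapping.lookup m w \<le> deg_in w f" by (simp add: lookup_add)
qed

text \<open>Strict also when the derivative vanishes, because 0 has degree 0 and \<open>f\<close>
  has positive degree in \<open>u\<close>.\<close>

lemma deg_in_partial_deriv_less:
  fixes f :: "('d, 'y, 'k::comm_semiring_1) dpoly"
  assumes "u \<in> dvars f"
  shows "deg_in u (partial_deriv u f) < deg_in u f"
proof -
  have "deg_in u (partial_deriv u f) \<le> deg_in u f - 1"
    unfolding deg_in_le_iff
  proof
    fix m assume "m \<in> Poly_Mapping.keys (partial_deriv u f)"
    from lookup_le_deg_in[OF key_partial_deriv[OF this], of u]
    show "Poly_Mapping.lookup m u \<le> deg_in u f - 1" by (simp add: lookup_add)
  qed
  moreover have "deg_in u f \<noteq> 0" using assms by (simp add: deg_in_eq_0_iff)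
  ultimately show ?thesis by simp
qed

text \<open>Characteristic zero enters here: a positive exponent remains nonzero as a
  scalar.\<close>

lemma partial_deriv_nonzero:
  fixes f :: "('d, 'y, 'k::field_char_0) dpoly"
  assumes "u \<in> dvars f"
  shows "partial_deriv u f \<noteq> 0"
proof -
  obtain m where m: "m \<in> Poly_Mapping.keys f" "Poly_Mapping.lookup m u \<noteq> 0"
    using assms unfolding in_dvars_iff by blast
  have "m - Poly_Mapping.single u 1 + Poly_Mapping.single u 1 = m"
    using m by (intro minus_single_add_single) simp
  then have "Poly_Mapping.lookup (partial_deriv u f) (m - Poly_Mapping.single u 1) =
      of_nat (Poly_Mapping.lookup m u) * Poly_Mapping.lookup f m"
    using m(2) by (simp add: lookup_partial_deriv lookup_minus del: of_nat_Suc)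
  also have "\<dots> \<noteq> 0" using m by (simp add: in_keys_iff)
  finally show ?thesis by auto
qed

lemma coeff_in_partial_deriv:
  fixes f :: "('d, 'y, 'k::comm_semiring_1) dpoly"
  assumes "u \<noteq> v"
  shows "coeff_in u d (partial_deriv v f) = partial_deriv v (coeff_in u d f)"
  using assms
  by (intro poly_mapping_eqI)
    (simp add: lookup_coeff_in lookup_partial_deriv lookup_add lookup_single when_def add_ac)

lemma partial_deriv_zero_of_free:
  fixes f :: "('d, 'y, 'k::comm_semiring_1) dpoly"
  assumes "u \<notin> dvars f"
  shows "partial_deriv u f = 0"
proof (rule poly_mapping_eqI)
  fix m
  have "m + Poly_Mapping.single u 1 \<notin> Poly_Mapping.keys f"
    using assms in_dvarsI[of "m + Poly_Mapping.single u 1" f u] by (auto simp: lookup_add)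
  then show "Poly_Mapping.lookup (partial_deriv u f) m = Poly_Mapping.lookup 0 m"
    by (simp add: lookup_partial_deriv in_keys_iff)
qed

section \<open>Rankings and leaders\<close>

lemma ranking_refl: "ranking R \<Longrightarrow> (u, u) \<in> R"
  unfolding ranking_def linear_order_on_def partial_order_on_def preorder_on_def refl_on_def by blast

lemma ranking_antisym: "ranking R \<Longrightarrow> (u, v) \<in> R \<Longrightarrow> (v, u) \<in> R \<Longrightarrow> u = v"
  unfolding ranking_def linear_order_on_def partial_order_on_def by (meson antisymD)

lemma ranking_trans: "ranking R \<Longrightarrow> (u, v) \<in> R \<Longrightarrow> (v, w) \<in> R \<Longrightarrow> (u, w) \<in> R"
  unfolding ranking_def linear_order_on_def partial_order_on_def preorder_on_def by (meson transD)

lemma ranking_total: "ranking R \<Longrightarrow> (u, v) \<in> R \<or> (v, u) \<in> R"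
  by (metis UNIV_I linear_order_on_def ranking_def ranking_refl total_on_def)

lemma ranking_apply_op: "ranking R \<Longrightarrow> (u, apply_op \<theta> u) \<in> R"
  unfolding ranking_def by blast

lemma apply_op_eq_self_iff: "apply_op \<theta> u = u \<longleftrightarrow> \<theta> = 0"
  by (simp add: apply_op_def prod_eq_iff)

lemma leader_greatest:
  assumes R: "ranking R" and f: "dvars f \<noteq> {}"
  shows leader_in_dvars: "leader R f \<in> dvars f"
    and le_leader: "w \<in> dvars f \<Longrightarrow> (w, leader R f) \<in> R"
proof -
  have "\<exists>u\<in>S. \<forall>w\<in>S. (w, u) \<in> R" if "finite S" "S \<noteq> {}" for S
    using that
  proof (induction S rule: finite_ne_induct)
    case (singleton x)
    then show ?case using ranking_refl[OF R] by simp
  next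
    case (insert x S)
    then obtain u where u: "u \<in> S" "\<forall>w\<in>S. (w, u) \<in> R" by blast
    show ?case
    proof (cases "(x, u) \<in> R")
      case True
      then show ?thesis using u by blast
    next
      case False
      then have "(u, x) \<in> R" using ranking_total[OF R] by blast
      then show ?thesis using u ranking_trans[OF R] ranking_refl[OF R, of x] by blast
    qed
  qed
  then obtain u where u: "u \<in> dvars f" "\<forall>w\<in>dvars f. (w, u) \<in> R"
    using f finite_dvars by meson
  have "leader R f = u"
    unfolding leader_def using u ranking_antisym[OF R] by (intro the_equality) blast+
  then show "leader R f \<in> dvars f" "w \<in> dvars f \<Longrightarrow> (w, leader R f) \<in> R"
    using u by auto
qed

lemma derivative_of_leader_notin_dvars:
  assumes R: "ranking R" and "\<theta> \<noteq> 0"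
  shows "apply_op \<theta> (leader R f) \<notin> dvars f"
proof
  assume *: "apply_op \<theta> (leader R f) \<in> dvars f"
  then have "(apply_op \<theta> (leader R f), leader R f) \<in> R" using le_leader[OF R] by blast
  then have "apply_op \<theta> (leader R f) = leader R f"
    using ranking_antisym[OF R] ranking_apply_op[OF R] by blast
  then show False using assms(2) by (simp add: apply_op_eq_self_iff)
qed

lemma deg_in_leader_pos:
  "ranking R \<Longrightarrow> dvars f \<noteq> {} \<Longrightarrow> 0 < deg_in (leader R f) f"
  using leader_in_dvars[of R f] deg_in_eq_0_iff[of "leader R f" f] by simp

text \<open>
  If \<open>f\<close> were not constant, then the elements of \<open>Cs\<close> of rank lower than \<open>f\<close>, followed by \<open>f\<close>,
  would form an autoreduced subset of lower rank than \<open>Cs\<close>.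
\<close>

lemma reduced_element_of_ideal_const:
  fixes f :: "('d, 'y, 'k::zero) dpoly"
  assumes R: "ranking R" and cs: "characteristic_set R J Cs"
    and f: "f \<in> J" and red: "\<And>C. C \<in> set Cs \<Longrightarrow> reduced_wrt R f C"
  shows "dvars f = {}"
proof (rule ccontr)
  assume ne: "dvars f \<noteq> {}"
  define P where "P = (\<lambda>C :: ('d, 'y, 'k) dpoly. rank_less R (rank_of R C) (rank_of R f))"
  define Bs where "Bs = takeWhile P Cs @ [f]"
  let ?k = "length (takeWhile P Cs)"
  have auto_Cs: "autoreduced R (set Cs)" and sorted: "sorted_wrt (\<lambda>f g. rank_less R (rank_of R f) (rank_of R g)) Cs"
    and CsJ: "set Cs \<subseteq> J" and lowest: "\<And>Bs. autoreduced_seq R Bs \<Longrightarrow> set Bs \<subseteq> J \<Longrightarrow> \<not> lower_rank R Bs Cs"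
    using cs by (auto simp: characteristic_set_def autoreduced_seq_def)
  have setB: "C \<in> set Cs \<and> P C" if "C \<in> set (takeWhile P Cs)" for C
    using that set_takeWhileD by metis
  \<comment> \<open>A common leader would give \<open>C\<close> the smaller degree by rank and
    \<open>f\<close> the smaller degree by reducedness. So \<open>C\<close> has a strictly lower
    leader, and neither the leader of \<open>f\<close> nor any of its derivatives occurs in
    \<open>C\<close>.\<close>
  have "reduced_wrt R C f" if C: "C \<in> set Cs" "P C" for C
  proof -
    have "leader R C \<noteq> leader R f"
      using C(2) red[OF C(1)] by (auto simp: P_def rank_less_def rank_of_def reduced_wrt_def)
    then have lt: "(leader R C, leader R f) \<in> R"
      using C(2) by (auto simp: P_def rank_less_def rank_of_def)
    have notin: "x \<notin> dvars C" if x: "(leader R f, x) \<in> R" for x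
    proof
      assume "x \<in> dvars C"
      then have "(x, leader R C) \<in> R" using le_leader[OF R] by blast
      then have "(leader R f, leader R C) \<in> R" using ranking_trans[OF R x] by blast
      then show False using ranking_antisym[OF R lt] \<open>leader R C \<noteq> leader R f\<close> by blast
    qed
    have "deg_in (leader R f) C = 0"
      unfolding deg_in_eq_0_iff using notin ranking_refl[OF R] by blast
    then show ?thesis
      unfolding reduced_wrt_def
      using notin ranking_apply_op[OF R] deg_in_leader_pos[OF R ne] by auto
  qed
  then have "autoreduced R (set Bs)"
    using auto_Cs red setB ne unfolding autoreduced_def Bs_def dvars_empty_iff by fastforce
  moreover have "sorted_wrt (\<lambda>f g. rank_less R (rank_of R f) (rank_of R g)) Bs"
  proof -
    have "sorted_wrt (\<lambda>f g. rank_less R (rank_of R f) (rank_of R g)) (takeWhile P Cs)"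
      using sorted_wrt_take[OF sorted, of ?k] takeWhile_eq_take[of P Cs] by simp
    then show ?thesis unfolding Bs_def sorted_wrt_append using setB by (auto simp: P_def)
  qed
  ultimately have seq: "autoreduced_seq R Bs" by (simp add: autoreduced_seq_def)
  have nth: "Bs ! i = Cs ! i" if "i < ?k" for i
    using that by (simp add: Bs_def nth_append takeWhile_nth)
  have "lower_rank R Bs Cs"
  proof (cases "?k = length Cs")
    \<comment> \<open>Here \<open>Bs\<close> prolongs all of \<open>Cs\<close>, and the longer
      sequence has the lower rank.\<close>
    case True
    then show ?thesis unfolding lower_rank_def using nth by (simp add: Bs_def)
  next
    case False
    then have k: "?k < length Cs" using length_takeWhile_le[of P Cs] by linarith
    then have "\<not> P (Cs ! ?k)" by (rule nth_length_takeWhile)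
    moreover have "reduced_wrt R f (Cs ! ?k)" using red k by simp
    \<comment> \<open>Reducedness of \<open>f\<close> excludes equal ranks, so totality of the
      ranking leaves only the strict inequality.\<close>
    ultimately have "rank_less R (rank_of R f) (rank_of R (Cs ! ?k))"
      using ranking_total[OF R, of "leader R f" "leader R (Cs ! ?k)"]
      by (auto simp: P_def rank_less_def rank_of_def reduced_wrt_def)
    then have "rank_less R (rank_of R (Bs ! ?k)) (rank_of R (Cs ! ?k))"
      by (simp add: Bs_def)
    then show ?thesis unfolding lower_rank_def using nth k
      by (intro disjI1 exI[of _ ?k]) (simp add: Bs_def)
  qed
  moreover have "set Bs \<subseteq> J" using f CsJ setB by (auto simp: Bs_def)
  ultimately show False using lowest seq by blast
qed

section \<open>Evaluation and properness of characterizable ideals\<close>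

definition eval_pprod :: "('x \<Rightarrow> 'k::comm_semiring_1) \<Rightarrow> ('x \<Rightarrow>\<^sub>0 nat) \<Rightarrow> 'k" where
  "eval_pprod e m = (\<Prod>u\<in>Poly_Mapping.keys m. e u ^ Poly_Mapping.lookup m u)"

definition eval_dpoly :: "(('d, 'y) dvar \<Rightarrow> 'k::comm_semiring_1) \<Rightarrow> ('d, 'y, 'k) dpoly \<Rightarrow> 'k" where
  "eval_dpoly e f = (\<Sum>m\<in>Poly_Mapping.keys f. Poly_Mapping.lookup f m * eval_pprod e m)"

lemma eval_pprod_superset:
  assumes "finite S" "Poly_Mapping.keys m \<subseteq> S"
  shows "eval_pprod e m = (\<Prod>u\<in>S. e u ^ Poly_Mapping.lookup m u)"
  unfolding eval_pprod_def using assms by (intro prod.mono_neutral_left) (auto simp: in_keys_iff)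

lemma eval_pprod_add: "eval_pprod e (m + n) = eval_pprod e m * eval_pprod e n"
proof -
  let ?S = "Poly_Mapping.keys m \<union> Poly_Mapping.keys n"
  have "eval_pprod e (m + n) = (\<Prod>u\<in>?S. e u ^ Poly_Mapping.lookup (m + n) u)"
    using keys_add[of m n] by (intro eval_pprod_superset) auto
  also have "\<dots> = eval_pprod e m * eval_pprod e n"
    by (simp add: eval_pprod_superset[of ?S] lookup_add power_add prod.distrib)
  finally show ?thesis .
qed

lemma eval_dpoly_single: "eval_dpoly e (Poly_Mapping.single m c) = c * eval_pprod e m"
  by (simp add: eval_dpoly_def)

lemma eval_dpoly_0 [simp]: "eval_dpoly e 0 = 0"
  by (simp add: eval_dpoly_def)

lemma eval_dpoly_add: "eval_dpoly e (f + g) = eval_dpoly e f + eval_dpoly e g"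
  unfolding eval_dpoly_def by (rule setsum_keys_plus_distrib) (simp_all add: distrib_right)

lemma eval_dpoly_sum: "eval_dpoly e (\<Sum>i\<in>S. f i) = (\<Sum>i\<in>S. eval_dpoly e (f i))"
  by (induction S rule: infinite_finite_induct) (simp_all add: eval_dpoly_add)

lemma eval_dpoly_mult: "eval_dpoly e (f * g) = eval_dpoly e f * eval_dpoly e g"
proof -
  have "eval_dpoly e (Poly_Mapping.single m c * g) = eval_dpoly e (Poly_Mapping.single m c) * eval_dpoly e g"
    for m c
    by (induction g rule: poly_mapping_add_single_induct)
      (simp_all add: eval_dpoly_add distrib_left mult_single eval_dpoly_single eval_pprod_add mult_ac)
  then show ?thesis
    by (induction f rule: poly_mapping_add_single_induct)
      (simp_all add: eval_dpoly_add distrib_right)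
qed

lemma eval_dpoly_const [simp]: "eval_dpoly e (const_dpoly c) = c"
  by (simp add: const_dpoly_def eval_dpoly_single eval_pprod_def)

lemma eval_dpoly_var [simp]: "eval_dpoly e (var_dpoly u) = e u"
  by (simp add: var_dpoly_def eval_dpoly_single eval_pprod_def)

lemma eval_dpoly_power: "eval_dpoly e (f ^ n) = eval_dpoly e f ^ n"
  by (induction n) (simp_all add: eval_dpoly_mult flip: const_dpoly_one)

section \<open>Calculus in a differential field\<close>

lemma differential_field_simps:
  assumes "differential_field der"
  shows differential_field_add: "der i (a + b) = der i a + der i b"
    and differential_field_mult: "der i (a * b) = der i a * b + a * der i b"
    and differential_field_commute: "der i (der j a) = der j (der i a)"
    and differential_field_0: "der i 0 = 0"
    and differential_field_1: "der i 1 = 0"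
    and differential_field_sum: "der i (\<Sum>x\<in>S. h x) = (\<Sum>x\<in>S. der i (h x))"
proof -
  show add: "der i (a + b) = der i a + der i b"
    and mult: "der i (a * b) = der i a * b + a * der i b"
    and "der i (der j a) = der j (der i a)" for a b
    using assms unfolding differential_field_def by blast+
  show 0: "der i 0 = 0" using add[of 0 0] by (metis add.right_neutral add_left_cancel)
  show "der i 1 = 0" using mult[of 1 1] by (metis add.right_neutral add_left_cancel mult_1 mult_1_right)
  show "der i (\<Sum>x\<in>S. h x) = (\<Sum>x\<in>S. der i (h x))"
    by (induction S rule: infinite_finite_induct) (simp_all add: 0 add)
qed

lemma differential_field_power:
  assumes "differential_field der"
  shows "der i (a ^ n) = of_nat n * a ^ (n - 1) * der i a"
proof (induction n)
  case (Suc n)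
  then show ?case
    by (cases n) (simp_all add: differential_field_simps[OF assms] algebra_simps)
qed (simp add: differential_field_simps[OF assms])

lemma differential_field_prod:
  assumes "differential_field der" "finite S"
  shows "der i (\<Prod>u\<in>S. h u) = (\<Sum>u\<in>S. der i (h u) * (\<Prod>w\<in>S-{u}. h w))"
  using assms(2)
proof (induction S rule: finite_induct)
  case (insert x S)
  have "der i (h u) * (\<Prod>w\<in>insert x S - {u}. h w) = h x * (der i (h u) * (\<Prod>w\<in>S - {u}. h w))"
    if "u \<in> S" for u
  proof -
    have "insert x S - {u} = insert x (S - {u})" using that insert by auto
    then show ?thesis using insert by (simp add: mult_ac)
  qed
  then have "(\<Sum>u\<in>S. der i (h u) * (\<Prod>w\<in>insert x S - {u}. h w)) =
      h x * (\<Sum>u\<in>S. der i (h u) * (\<Prod>w\<in>S - {u}. h w))"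
    unfolding sum_distrib_left by (rule sum.cong[OF refl])
  moreover have "insert x S - {x} = S" using insert by auto
  ultimately show ?case
    using insert by (simp add: differential_field_simps[OF assms(1)])
qed (simp add: differential_field_simps[OF assms(1)])

section \<open>Total derivatives and the chain rule\<close>

lemma partial_deriv_single:
  fixes c :: "'k::comm_semiring_1"
  shows "partial_deriv u (Poly_Mapping.single m c) =
    Poly_Mapping.single (m - Poly_Mapping.single u 1) (of_nat (Poly_Mapping.lookup m u) * c)"
  by (simp add: partial_deriv_def)

lemma partial_deriv_add:
  fixes f g :: "('d, 'y, 'k::comm_semiring_1) dpoly"
  shows "partial_deriv u (f + g) = partial_deriv u f + partial_deriv u g"
  by (intro poly_mapping_eqI) (simp add: lookup_partial_deriv lookup_add algebra_simps)

text \<open>Absent variables have zero partial derivative, so the chain rule sums of several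
  polynomials can share one index set.\<close>

lemma total_deriv_superset:
  assumes "finite S" "dvars f \<subseteq> S"
  shows "total_deriv der i f = Poly_Mapping.map (der i) f +
    (\<Sum>u\<in>S. partial_deriv u f * var_dpoly (apply_op (Poly_Mapping.single i 1) u))"
  unfolding total_deriv_def using assms
  by (intro arg_cong2[of _ _ _ _ "(+)"] refl sum.mono_neutral_left)
    (auto simp: partial_deriv_zero_of_free)

lemma total_deriv_add:
  assumes "differential_field der"
  shows "total_deriv der i (f + g) = total_deriv der i f + total_deriv der i g"
proof -
  let ?S = "dvars f \<union> dvars g"
  have "Poly_Mapping.map (der i) (f + g) = Poly_Mapping.map (der i) f + Poly_Mapping.map (der i) g"
    by (intro poly_mapping_eqI)
      (simp add: map.rep_eq lookup_add when_def differential_field_simps[OF assms] flip: differential_field_add[OF assms])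
  then show ?thesis
    using total_deriv_superset[of ?S "f + g" der i] total_deriv_superset[of ?S f der i]
      total_deriv_superset[of ?S g der i] dvars_add[of f g]
    by (simp add: partial_deriv_add distrib_right sum.distrib)
qed

text \<open>Both sides are additive in \<open>f\<close>; on a single term the claim is the product
  rule for \<open>c * eval_pprod e m\<close>.\<close>

lemma eval_total_deriv:
  fixes f :: "('d, 'y, 'k::field) dpoly"
  assumes diff: "differential_field der"
    and e: "\<And>i u. e (apply_op (Poly_Mapping.single i 1) u) = der i (e u)"
  shows "eval_dpoly e (total_deriv der i f) = der i (eval_dpoly e f)"
proof (induction f rule: poly_mapping_add_single_induct)
  case zero
  have "Poly_Mapping.map (der i) 0 = (0 :: ('d, 'y, 'k) dpoly)"
    by (simp add: Poly_Mapping.map_eq_zero_iff)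
  then show ?case by (simp add: total_deriv_def differential_field_simps[OF diff])
next
  case (add m c f)
  let ?S = "Poly_Mapping.keys m"
  have sub: "dvars (Poly_Mapping.single m c) \<subseteq> ?S" by (simp add: dvars_def)
  \<comment> \<open>The summand at \<open>u\<close> in the Leibniz expansion of the evaluated power
    product.\<close>
  have ev: "of_nat (Poly_Mapping.lookup m u) * eval_pprod e (m - Poly_Mapping.single u 1) * der i (e u) =
      der i (e u ^ Poly_Mapping.lookup m u) * (\<Prod>w\<in>?S-{u}. e w ^ Poly_Mapping.lookup m w)"
    if "u \<in> ?S" for u
  proof -
    have "eval_pprod e (m - Poly_Mapping.single u 1) =
        (\<Prod>w\<in>?S. e w ^ Poly_Mapping.lookup (m - Poly_Mapping.single u 1) w)"
      by (intro eval_pprod_superset) (auto simp: in_keys_iff lookup_minus)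
    also have "\<dots> = e u ^ (Poly_Mapping.lookup m u - 1) *
        (\<Prod>w\<in>?S-{u}. e w ^ Poly_Mapping.lookup (m - Poly_Mapping.single u 1) w)"
      using that by (simp add: prod.remove lookup_minus)
    also have "(\<Prod>w\<in>?S-{u}. e w ^ Poly_Mapping.lookup (m - Poly_Mapping.single u 1) w) =
        (\<Prod>w\<in>?S-{u}. e w ^ Poly_Mapping.lookup m w)"
      by (intro prod.cong refl) (auto simp: lookup_minus lookup_single when_def)
    finally show ?thesis
      by (simp add: differential_field_power[OF diff] mult_ac)
  qed
  have "eval_dpoly e (total_deriv der i (Poly_Mapping.single m c)) =
      der i c * eval_pprod e m + (\<Sum>u\<in>?S. of_nat (Poly_Mapping.lookup m u) * c *
        eval_pprod e (m - Poly_Mapping.single u 1) * der i (e u))"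
    by (simp add: total_deriv_superset[OF _ sub] eval_dpoly_add eval_dpoly_sum eval_dpoly_mult
        eval_dpoly_single partial_deriv_single e when_def differential_field_simps[OF diff] del: One_nat_def)
  also have "(\<Sum>u\<in>?S. of_nat (Poly_Mapping.lookup m u) * c *
        eval_pprod e (m - Poly_Mapping.single u 1) * der i (e u)) =
      (\<Sum>u\<in>?S. c * (of_nat (Poly_Mapping.lookup m u) *
        eval_pprod e (m - Poly_Mapping.single u 1) * der i (e u)))"
    by (simp only: mult_ac)
  also have "\<dots> = c * der i (eval_pprod e m)"
    unfolding eval_pprod_def[of e m] differential_field_prod[OF diff finite_keys] sum_distrib_left
    by (intro sum.cong refl) (simp only: ev)
  also have "der i c * eval_pprod e m + c * der i (eval_pprod e m) =
      der i (eval_dpoly e (Poly_Mapping.single m c))"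
    by (simp add: eval_dpoly_single differential_field_simps[OF diff])
  finally show ?case
    using add by (simp add: total_deriv_add[OF diff] eval_dpoly_add differential_field_simps[OF diff])
qed

text \<open>The action of the operator \<theta> on the coefficient field. For commuting derivations
  the order of the fold is immaterial.\<close>

definition apply_der :: "('d \<Rightarrow> 'k \<Rightarrow> 'k) \<Rightarrow> ('d \<Rightarrow>\<^sub>0 nat) \<Rightarrow> 'k \<Rightarrow> 'k" where
  "apply_der der \<theta> x = Finite_Set.fold (\<lambda>i. der i ^^ Poly_Mapping.lookup \<theta> i) x UNIV"

lemma apply_der_0 [simp]:
  fixes der :: "'d::finite \<Rightarrow> 'k \<Rightarrow> 'k"
  shows "apply_der der 0 x = x"
proof -
  have "Finite_Set.fold (\<lambda>i a. a) x S = x" if "finite S" for S :: "'d set"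
  proof -
    interpret comp_fun_commute "\<lambda>(i :: 'd) (a :: 'k). a" by standard simp
    show ?thesis using that by (induction S rule: finite_induct) simp_all
  qed
  then show ?thesis by (simp add: apply_der_def id_def)
qed

lemma apply_der_Suc:
  fixes der :: "'d::finite \<Rightarrow> 'k::field \<Rightarrow> 'k"
  assumes "differential_field der"
  shows "apply_der der (Poly_Mapping.single i 1 + \<theta>) x = der i (apply_der der \<theta> x)"
proof -
  interpret comp_fun_commute der
    by standard (simp add: fun_eq_iff differential_field_commute[OF assms])
  let ?f = "\<lambda>\<theta> j. der j ^^ Poly_Mapping.lookup \<theta> j"
  have comm: "comp_fun_commute_on UNIV (?f \<theta>)" for \<theta>
    by (rule comp_fun_commute_on_funpow)
  \<comment> \<open>Index \<open>i\<close> is made the outermost step; the fold over the other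
    indices does not see the additional exponent.\<close>
  have fold: "Finite_Set.fold (?f \<theta>) x UNIV = ?f \<theta> i (Finite_Set.fold (?f \<theta>) x (UNIV - {i}))" for \<theta>
    using comp_fun_commute_on.fold_rec[OF comm[of \<theta>], of UNIV i x] by simp
  have "Finite_Set.fold (?f (Poly_Mapping.single i 1 + \<theta>)) x (UNIV - {i}) =
      Finite_Set.fold (?f \<theta>) x (UNIV - {i})"
    by (intro Finite_Set.fold_cong[of UNIV] comm) (auto simp: lookup_add lookup_single_not_eq)
  then show ?thesis
    unfolding apply_der_def fold[of "Poly_Mapping.single i 1 + \<theta>"] fold[of \<theta>]
    by (simp add: lookup_add)
qed

text \<open>If 1 were in the saturation, a power of \<open>H_prod R As\<close> would lie in the
  differential ideal generated by \<open>As\<close>. The kernel of a suitable evaluation is a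
  differential ideal that contains \<open>As\<close> but no such power.\<close>

lemma one_notin_characterizable:
  fixes der :: "'d::finite \<Rightarrow> 'k::field_char_0 \<Rightarrow> 'k"
    and I :: "('d, 'y, 'k) dpoly set"
  assumes diff: "differential_field der" and R: "ranking R" and char: "characterizable der R I"
  shows "1 \<notin> I"
proof
  assume 1: "1 \<in> I"
  obtain As where dI: "differential_ideal der I" and cs: "characteristic_set R I As"
    and I: "I = saturation (generated_differential_ideal der (set As)) (H_prod R As)"
    using char by (auto simp: characterizable_def)
  have auto_As: "\<And>A B. A \<in> set As \<Longrightarrow> B \<in> set As \<Longrightarrow> A \<noteq> B \<Longrightarrow> reduced_wrt R A B"
    and nonconst: "\<And>A. A \<in> set As \<Longrightarrow> dvars A \<noteq> {}"
    using cs unfolding characteristic_set_def autoreduced_seq_def autoreduced_def dvars_empty_iff by blast+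
  have deriv0: "\<theta> = 0" if "apply_op \<theta> u = (0, j)" for \<theta> :: "'d \<Rightarrow>\<^sub>0 nat" and u :: "('d, 'y) dvar" and j
  proof (rule poly_mapping_eqI)
    fix i
    have "\<theta> + fst u = 0" using that by (simp add: apply_op_def)
    then have "Poly_Mapping.lookup (\<theta> + fst u) i = 0" by simp
    then show "Poly_Mapping.lookup \<theta> i = Poly_Mapping.lookup 0 i" by (simp add: lookup_add)
  qed
  \<comment> \<open>The variable y_j itself lies in the unit ideal and is not constant, so it is not
    reduced with respect to some \<open>A\<close>. It is no proper derivative of a leader, so the
    degree condition fails, and this forces leader y_j and degree 1.\<close>
  have ex: "\<exists>A\<in>set As. leader R A = (0, j) \<and> deg_in (0, j) A = 1" for j
  proof -
    let ?y = "var_dpoly (0, j) :: ('d, 'y, 'k) dpoly"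
    have "?y * 1 \<in> I" using 1 dI unfolding differential_ideal_def by blast
    then have "\<not> (\<forall>A\<in>set As. reduced_wrt R ?y A)"
      using reduced_element_of_ideal_const[OF R cs, of ?y] by auto
    then obtain A where A: "A \<in> set As" "\<not> reduced_wrt R ?y A" by blast
    have "deg_in (leader R A) A \<le> deg_in (leader R A) ?y"
      using A(2) deriv0 unfolding reduced_wrt_def by fastforce
    moreover have pos: "0 < deg_in (leader R A) A" using deg_in_leader_pos[OF R nonconst[OF A(1)]] .
    ultimately have "leader R A \<in> dvars ?y" using deg_in_eq_0_iff[of "leader R A" ?y] by simp
    then have "leader R A = (0, j)" by simp
    moreover have "deg_in (0, j) ?y = 1" by (simp add: deg_in_def var_dpoly_def)
    ultimately show ?thesis
      using A(1) pos \<open>deg_in (leader R A) A \<le> deg_in (leader R A) ?y\<close> by (intro bexI[of _ A]) auto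
  qed
  \<comment> \<open>Any \<open>w\<close> in \<open>A\<close> is a derivative of the leader of some
    \<open>B\<close> of degree 1. Autoreducedness first makes the derivative trivial and then
    identifies \<open>A\<close> with \<open>B\<close>.\<close>
  have linear: "w = leader R A \<and> leader R A = (0, snd w) \<and> deg_in w A = 1"
    if A: "A \<in> set As" and w: "w \<in> dvars A" for A w
  proof -
    obtain B where B: "B \<in> set As" "leader R B = (0, snd w)" "deg_in (0, snd w) B = 1"
      using ex by blast
    have w_eq: "w = apply_op (fst w) (0, snd w)" by (simp add: apply_op_def)
    have "w = (0, snd w)" if "reduced_wrt R A B \<or> A = B"
    proof (rule ccontr)
      assume "w \<noteq> (0, snd w)"
      then have "fst w \<noteq> 0" by (metis prod.collapse)
      moreover have "apply_op (fst w) (leader R B) \<in> dvars A" using w w_eq B(2) by simp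
      ultimately show False
        using \<open>reduced_wrt R A B \<or> A = B\<close> derivative_of_leader_notin_dvars[OF R, of "fst w" A]
        unfolding reduced_wrt_def by blast
    qed
    then have w0: "w = (0, snd w)" using auto_As[OF A B(1)] by blast
    have "A = B"
    proof (rule ccontr)
      assume "A \<noteq> B"
      then have "deg_in w A < 1"
        using auto_As[OF A B(1)] B(2,3) w0 unfolding reduced_wrt_def by metis
      then show False using deg_in_eq_0_iff[of w A] w by simp
    qed
    then show ?thesis using B w0 by metis
  qed
  have form: "\<exists>a b. A = const_dpoly b + const_dpoly a * var_dpoly (leader R A) \<and> a \<noteq> 0 \<and>
      initial_of R A = const_dpoly a \<and> separant_of R A = const_dpoly a" if A: "A \<in> set As" for A
  proof -
    let ?u = "leader R A"
    have u: "?u \<in> dvars A" by (rule leader_in_dvars[OF R nonconst[OF A]])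
    have vars: "dvars A = {?u}" using linear[OF A] u by blast
    have deg: "deg_in ?u A = 1" using linear[OF A u] by simp
    have "dvars (coeff_in ?u n A) = {}" for n using dvars_coeff_in[of ?u n A] vars by blast
    then have "\<exists>c. coeff_in ?u n A = const_dpoly c" for n
      unfolding dvars_empty_iff by blast
    then obtain c where c: "\<And>n. coeff_in ?u n A = const_dpoly (c n)" by metis
    have "A \<noteq> 0" using u by auto
    then have c1: "c 1 \<noteq> 0" using coeff_in_deg_in_nonzero[of A ?u] by (simp add: c deg)
    have "A = poly (upoly ?u A) (var_dpoly ?u)" by (simp add: dpoly_expand)
    also have "\<dots> = const_dpoly (c 0) + const_dpoly (c 1) * var_dpoly ?u"
      by (simp add: poly_altdef degree_upoly deg c)
    finally have A_eq: "A = const_dpoly (c 0) + const_dpoly (c 1) * var_dpoly ?u" .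
    have mono: "const_dpoly (c 1) * var_dpoly w = Poly_Mapping.single (Poly_Mapping.single w 1) (c 1)" for w
      by (simp add: const_dpoly_def var_dpoly_def mult_single)
    have "partial_deriv w (const_dpoly (c 0) + const_dpoly (c 1) * var_dpoly w) = const_dpoly (c 1)"
      for w
      unfolding partial_deriv_add mono by (simp add: partial_deriv_single const_dpoly_def)
    then have "partial_deriv ?u A = const_dpoly (c 1)"
      using A_eq by metis
    then show ?thesis
      using A_eq c1 c[of 1] deg by (auto simp: initial_of_def separant_of_def)
  qed
  \<comment> \<open>The value is the root \<open>- b / a\<close> of the unique element with leader
    y_j.\<close>
  have "\<exists>x. \<forall>A\<in>set As. leader R A = (0, j) \<longrightarrow> (\<forall>e. e (0, j) = x \<longrightarrow> eval_dpoly e A = 0)" for j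
  proof -
    obtain A where A: "A \<in> set As" "leader R A = (0, j)" "deg_in (0, j) A = 1" using ex by blast
    have unique: "B = A" if "B \<in> set As" "leader R B = (0, j)" for B
    proof (rule ccontr)
      assume "B \<noteq> A"
      then have "deg_in (0, j) B < 1"
        using auto_As[OF that(1) A(1)] A(2,3) unfolding reduced_wrt_def by simp
      then show False using deg_in_leader_pos[OF R nonconst[OF that(1)]] that(2) by simp
    qed
    obtain a b where "A = const_dpoly b + const_dpoly a * var_dpoly (0, j)" "a \<noteq> 0"
      using form[OF A(1)] A(2) by auto
    then have "eval_dpoly e A = 0" if "e (0, j) = - b / a" for e
      using that by (simp add: eval_dpoly_add eval_dpoly_mult)
    then show ?thesis using unique by (intro exI[of _ "- b / a"]) auto
  qed
  then obtain c where c: "\<And>j A e. A \<in> set As \<Longrightarrow> leader R A = (0, j) \<Longrightarrow> e (0, j) = c j \<Longrightarrow>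
      eval_dpoly e A = 0"
    by metis
  \<comment> \<open>The derivatives of y_j are sent to the derivatives of its value
    \<open>c j\<close>, which makes the evaluation commute with all derivations.\<close>
  define e where "e u = apply_der der (fst u) (c (snd u))" for u :: "('d, 'y) dvar"
  have e_der: "e (apply_op (Poly_Mapping.single i 1) u) = der i (e u)" for i u
    by (simp add: e_def apply_op_def apply_der_Suc[OF diff] del: One_nat_def)
  define J where "J = {f. eval_dpoly e f = 0}"
  have "differential_ideal der J"
    unfolding differential_ideal_def J_def
    by (simp add: eval_dpoly_add eval_dpoly_mult eval_total_deriv[where e = e, OF diff e_der]
        differential_field_0[OF diff])
  moreover have "set As \<subseteq> J"
  proof
    fix A assume A: "A \<in> set As"
    have "leader R A \<in> dvars A" by (rule leader_in_dvars[OF R nonconst[OF A]])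
    from linear[OF A this] have "leader R A = (0, snd (leader R A))" by simp
    moreover have "e (0, j) = c j" for j by (simp add: e_def)
    ultimately show "A \<in> J" unfolding J_def using c[OF A] by blast
  qed
  ultimately have sub: "generated_differential_ideal der (set As) \<subseteq> J"
    unfolding generated_differential_ideal_def by blast
  have "eval_dpoly e (H_prod R Bs) \<noteq> 0" if "set Bs \<subseteq> set As" for Bs
    using that
  proof (induction Bs)
    case Nil
    then show ?case by (simp add: H_prod_def flip: const_dpoly_one)
  next
    case (Cons A Bs)
    then obtain a where "a \<noteq> 0" "initial_of R A = const_dpoly a" "separant_of R A = const_dpoly a"
      using form[of A] by auto
    then show ?case using Cons by (simp add: H_prod_def eval_dpoly_mult)
  qed
  then have H: "eval_dpoly e (H_prod R As) \<noteq> 0" by blast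
  obtain n where "H_prod R As ^ n * 1 \<in> generated_differential_ideal der (set As)"
    using 1 unfolding I saturation_def by blast
  then have "eval_dpoly e (H_prod R As ^ n) = 0" using sub by (auto simp: J_def)
  then show False using H by (simp add: eval_dpoly_power)
qed

section \<open>Partial derivatives of a canonical characteristic set\<close>

lemma partial_deriv_notin:
  fixes der :: "'d \<Rightarrow> 'k::field_char_0 \<Rightarrow> 'k"
    and I :: "('d, 'y, 'k) dpoly set"
  assumes R: "ranking R"
    and diff: "differential_ideal der I"
    and proper: "1 \<notin> I"
    and canonical: "canonical_characteristic_set R I Cs"
    and C: "C \<in> set Cs"
    and v: "v \<in> dvars C"
  shows "partial_deriv v C \<notin> I"
proof
  define u where "u = leader R C"
  define d where "d = deg_in u C"
  define a where "a = coeff_in u d C"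
  define D where "D = partial_deriv v C"
  define N where "N = nonleaders R Cs"
  assume "partial_deriv v C \<in> I"
  then have DI: "D \<in> I" by (simp add: D_def)
  have cs: "characteristic_set R I Cs" and aN: "a \<in> polys_in N"
    and factor: "\<And>g. g \<in> polys_in N \<Longrightarrow> g dvd C \<Longrightarrow> dvars g = {}"
    using canonical C unfolding dvars_empty_iff
    by (auto simp: canonical_characteristic_set_def N_def a_def d_def u_def initial_of_def)
  have CI: "C \<in> I" and auto_Cs: "autoreduced R (set Cs)"
    using cs C by (auto simp: characteristic_set_def autoreduced_seq_def)
  have ideal: "f + g \<in> I" "h * f \<in> I" if "f \<in> I" "g \<in> I" for f g h
    using diff that by (auto simp: differential_ideal_def)
  have ne: "dvars C \<noteq> {}" using v by blast
  then have C0: "C \<noteq> 0" by auto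
  have u: "u \<in> dvars C" using leader_in_dvars[OF R ne] by (simp add: u_def)
  have reduced_zero: "f = 0" if f: "f \<in> I" "\<And>C'. C' \<in> set Cs \<Longrightarrow> reduced_wrt R f C'" for f
  proof (rule ccontr)
    assume "f \<noteq> 0"
    then have "f dvd 1"
      using reduced_element_of_ideal_const[OF R cs f] by (simp add: unit_dpoly_iff)
    then obtain g where "1 = f * g" by (elim dvdE)
    then have "1 \<in> I" using ideal(2)[OF f(1) f(1), of g] by (simp add: mult.commute)
    then show False using proper by simp
  qed
  \<comment> \<open>Reducedness with respect to the other elements of \<open>Cs\<close> is inherited
    from \<open>C\<close>, since \<open>f\<close> has no new variables and no larger degrees in
    leaders.\<close>
  have reduced: "f = 0" if f: "f \<in> I" "dvars f \<subseteq> dvars C" "deg_in u f < d"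
    "\<And>w. w \<in> leader R ` set Cs \<Longrightarrow> deg_in w f \<le> deg_in w C" for f
  proof (rule reduced_zero[OF f(1)])
    fix C' assume C': "C' \<in> set Cs"
    show "reduced_wrt R f C'"
    proof (cases "C' = C")
      case True
      then show ?thesis
        using f(2,3) derivative_of_leader_notin_dvars[OF R, of _ C]
        by (auto simp: reduced_wrt_def u_def d_def)
    next
      case False
      then have "reduced_wrt R C C'" using auto_Cs C C' by (auto simp: autoreduced_def)
      then show ?thesis
        using f(2) f(4)[of "leader R C'"] C' by (auto simp: reduced_wrt_def)
    qed
  qed
  have D_sub: "dvars D \<subseteq> dvars C" and D_deg: "deg_in w D \<le> deg_in w C" for w
    by (simp_all add: D_def dvars_partial_deriv deg_in_partial_deriv_le)
  have D0: "D \<noteq> 0" using v by (simp add: D_def partial_deriv_nonzero)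
  \<comment> \<open>A smaller degree in \<open>u\<close> would make \<open>D\<close> reduced and
    hence 0.\<close>
  have degD: "deg_in u D = d"
    using reduced[OF DI D_sub] D0 D_deg[of u] D_deg unfolding d_def by (meson le_neq_implies_less)
  then have uv: "u \<noteq> v"
    using deg_in_partial_deriv_less[OF v] by (auto simp: D_def d_def)
  define b where "b = partial_deriv v a"
  have b: "b = coeff_in u d D"
    using uv by (simp add: b_def a_def D_def coeff_in_partial_deriv)
  \<comment> \<open>This is the leading coefficient of \<open>D\<close> in \<open>u\<close>.\<close>
  then have b0: "b \<noteq> 0"
    using coeff_in_deg_in_nonzero[OF D0, of u] degD by simp
  then have va: "v \<in> dvars a" using partial_deriv_zero_of_free b_def by blast
  have a0: "a \<noteq> 0" using coeff_in_deg_in_nonzero[OF C0] by (simp add: a_def d_def)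
  have a_sub: "dvars a \<subseteq> dvars C - {u}" by (simp add: a_def dvars_coeff_in)
  have b_sub: "dvars b \<subseteq> dvars a" by (simp add: b_def dvars_partial_deriv)
  \<comment> \<open>The trivial operator excludes the leaders themselves from \<open>N\<close>, so
    multiplying by \<open>a\<close> or \<open>b\<close> raises no degree in a leader.\<close>
  have leader_notin: "w \<notin> dvars a" if "w \<in> leader R ` set Cs" for w
  proof -
    obtain f where "f \<in> set Cs" "w = apply_op 0 (leader R f)"
      using \<open>w \<in> leader R ` set Cs\<close> by (auto simp: apply_op_def)
    then have "w \<notin> N" unfolding N_def nonleaders_def by blast
    then show ?thesis using aN by (auto simp: polys_in_def)
  qed
  have "a * D - b * C = 0"
  proof (rule ccontr)
    assume E0: "a * D - b * C \<noteq> 0"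
    have sub: "dvars (a * D - b * C) \<subseteq> dvars C"
      using dvars_diff[of "a * D" "b * C"] dvars_mult[of a D] dvars_mult[of b C] a_sub b_sub D_sub
      by blast
    have deg: "deg_in w (a * D - b * C) \<le> deg_in w C" if w: "w \<in> leader R ` set Cs" for w
    proof -
      have "deg_in w a = 0" "deg_in w b = 0"
        using leader_notin[OF w] b_sub by (auto simp: deg_in_eq_0_iff)
      then have "deg_in w (a * D) \<le> deg_in w C" "deg_in w (b * C) \<le> deg_in w C"
        using deg_in_mult_le[of w a D] deg_in_mult_le[of w b C] D_deg[of w] by auto
      moreover have "deg_in w (a * D - b * C) \<le> max (deg_in w (a * D)) (deg_in w (b * C))"
        using degree_diff_le_max[of "upoly w (a * D)" "upoly w (b * C)"]
        by (simp add: degree_upoly flip: upoly_diff)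
      ultimately show ?thesis by simp
    qed
    have "u \<notin> dvars a" "u \<notin> dvars b" using a_sub b_sub by auto
    \<comment> \<open>The terms of degree \<open>d\<close> in \<open>u\<close> cancel in the
      difference.\<close>
    then have "coeff_in u d (a * D) = a * b" "coeff_in u d (b * C) = b * a"
      by (simp_all add: coeff_in_mult_free a_def b)
    then have "coeff_in u d (a * D - b * C) = 0"
      by (simp add: coeff_in_diff mult.commute)
    then have "deg_in u (a * D - b * C) \<noteq> d"
      using coeff_in_deg_in_nonzero[OF E0, of u] by auto
    then have "deg_in u (a * D - b * C) < d"
      using deg[of u] C by (auto simp: d_def u_def)
    moreover have "a * D - b * C \<in> I"
      using ideal(1)[OF ideal(2)[OF DI DI, of a] ideal(2)[OF CI CI, of "- b"]] by simp
    ultimately show False using reduced[OF _ sub _ deg] E0 by blast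
  qed
  then have "a dvd b * C" by (metis dvd_triv_left eq_iff_diff_eq_0)
  then obtain a1 a2 where a12: "a = a1 * a2" "a1 dvd b" "a2 dvd C"
    using dpoly_primal[OF a0] by blast
  then have nz: "a1 \<noteq> 0" "a2 \<noteq> 0" using a0 by auto
  \<comment> \<open>By canonicity \<open>a2\<close> is constant, so the whole degree of
    \<open>a\<close> in \<open>v\<close> sits in \<open>a1\<close>, which divides the derivative
    \<open>b\<close> of smaller degree.\<close>
  have "a2 \<in> polys_in N" using polys_in_dvd[OF _ a0 aN] a12(1) by simp
  then have "deg_in v a2 = 0" using factor a12(3) by (simp add: deg_in_eq_0_iff)
  then have "deg_in v a = deg_in v a1" using a12(1) nz by (simp add: deg_in_mult)
  also have "\<dots> \<le> deg_in v b" using dvd_deg_in_le[OF a12(2) b0] .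
  also have "\<dots> < deg_in v a" using deg_in_partial_deriv_less[OF va] by (simp add: b_def)
  finally show False by simp
qed

theorem proposition5:
  fixes der :: "'d::finite \<Rightarrow> 'k::field_char_0 \<Rightarrow> 'k"
    and R :: "(('d, 'y::finite) dvar) rel"
    and I :: "('d, 'y, 'k) dpoly set"
    and Cs :: "('d, 'y, 'k) dpoly list"
    and v :: "('d, 'y) dvar"
  assumes "differential_field der"
    and "ranking R"
    and "characterizable der R I"
    and "canonical_characteristic_set R I Cs"
    and "i < length Cs"
    and "v \<in> dvars (Cs ! i)"
  shows "partial_deriv v (Cs ! i) \<notin> I"
proof (rule partial_deriv_notin)
  show "differential_ideal der I" using assms(3) by (simp add: characterizable_def)
  show "1 \<notin> I" using one_notin_characterizable assms(1-3) .
  show "Cs ! i \<in> set Cs" using assms(5) by simp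
qed (use assms in auto)

end
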